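(* Let $p$ be a prime and $c$ a positive integer. Then: (i) there are only finitely many positive integers $r$ such that $\mathrm{Sp}_4(p^r)$ is a $(3,3,c)$-group; (ii) there are only finitely many positive integers $r$ such that $\mathrm{PSp}_4(p^r)$ is a $(3,3,c)$-group.
   Context: A finite group is a $(3,3,c)$-group if it is generated by two elements $x,y$ with $x^3=y^3=(xy)^c=1$. $\mathrm{Sp}_4(q)$ is the symplectic group of $4\times4$ matrices over the field $\mathbb{F}_q$ and $\mathrm{PSp}_4(q)$ its quotient by the centre. *)

theory Defs
  imports "HOL-Algebra.Algebra"
begin

definition mat4 :: "('a, 'b) ring_scheme \<Rightarrow> (nat \<Rightarrow> nat \<Rightarrow> 'a) set" where
  "mat4 R = {A. (\<forall>i j. i < 4 \<and> j < 4 \<longrightarrow> A i j \<in> carrier R) \<and>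
                (\<forall>i j. \<not> (i < 4 \<and> j < 4) \<longrightarrow> A i j = \<zero>\<^bsub>R\<^esub>)}"

definition mat4_mult :: "('a, 'b) ring_scheme \<Rightarrow> (nat \<Rightarrow> nat \<Rightarrow> 'a) \<Rightarrow> (nat \<Rightarrow> nat \<Rightarrow> 'a) \<Rightarrow> (nat \<Rightarrow> nat \<Rightarrow> 'a)" where
  "mat4_mult R A B = (\<lambda>i j. if i < 4 \<and> j < 4
       then finsum R (\<lambda>k. A i k \<otimes>\<^bsub>R\<^esub> B k j) {..<4} else \<zero>\<^bsub>R\<^esub>)"

definition mat4_one :: "('a, 'b) ring_scheme \<Rightarrow> (nat \<Rightarrow> nat \<Rightarrow> 'a)" where
  "mat4_one R = (\<lambda>i j. if i < 4 \<and> j < 4 \<and> i = j then \<one>\<^bsub>R\<^esub> else \<zero>\<^bsub>R\<^esub>)"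

definition mat4_transpose :: "(nat \<Rightarrow> nat \<Rightarrow> 'a) \<Rightarrow> (nat \<Rightarrow> nat \<Rightarrow> 'a)" where
  "mat4_transpose A = (\<lambda>i j. A j i)"

text \<open>The standard symplectic form J = [[0, I_2], [-I_2, 0]].\<close>
definition sympJ :: "('a, 'b) ring_scheme \<Rightarrow> (nat \<Rightarrow> nat \<Rightarrow> 'a)" where
  "sympJ R = (\<lambda>i j. if i < 4 \<and> j < 4 then
       (if j = i + 2 then \<one>\<^bsub>R\<^esub> else if i = j + 2 then \<ominus>\<^bsub>R\<^esub> \<one>\<^bsub>R\<^esub> else \<zero>\<^bsub>R\<^esub>)
     else \<zero>\<^bsub>R\<^esub>)"

definition Sp4 :: "('a, 'b) ring_scheme \<Rightarrow> (nat \<Rightarrow> nat \<Rightarrow> 'a) monoid" where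
  "Sp4 R = \<lparr> carrier = {A \<in> mat4 R.
                  mat4_mult R (mat4_mult R (mat4_transpose A) (sympJ R)) A = sympJ R},
             monoid.mult = mat4_mult R,
             monoid.one = mat4_one R \<rparr>"

definition group_center :: "('a, 'b) monoid_scheme \<Rightarrow> 'a set" where
  "group_center G = {z \<in> carrier G. \<forall>g \<in> carrier G. z \<otimes>\<^bsub>G\<^esub> g = g \<otimes>\<^bsub>G\<^esub> z}"

definition PSp4 :: "('a, 'b) ring_scheme \<Rightarrow> (nat \<Rightarrow> nat \<Rightarrow> 'a) set monoid" where
  "PSp4 R = Sp4 R Mod group_center (Sp4 R)"

definition is_33c_group :: "('a, 'b) monoid_scheme \<Rightarrow> nat \<Rightarrow> bool" where
  "is_33c_group G c \<longleftrightarrow> finite (carrier G) \<and>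
     (\<exists>x \<in> carrier G. \<exists>y \<in> carrier G.
        x [^]\<^bsub>G\<^esub> (3::nat) = \<one>\<^bsub>G\<^esub> \<and> y [^]\<^bsub>G\<^esub> (3::nat) = \<one>\<^bsub>G\<^esub> \<and>
        (x \<otimes>\<^bsub>G\<^esub> y) [^]\<^bsub>G\<^esub> c = \<one>\<^bsub>G\<^esub> \<and>
        generate G {x, y} = carrier G)"

end

theory Submission
  imports Defs "HOL-Algebra.Algebraic_Closure_Type" "HOL-Analysis.Cartesian_Space"
begin

text \<open>
  Over an algebraic closure, and after a change of sign, let x and y be the generators, so that
  x^3 = y^3 = (x y)^m = 1. In characteristic 3 both satisfy x^2 + x + 1 = 0; otherwise each of
  them either does so or has eigenvalues 1, 1, w, w^2 with w a primitive cube root of unity.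
  In each case the pair is rigid: the entries of x and y on a suitable spanning set of a nonzero
  invariant subspace are algebraic, of bounded degree, over the eigenvalues of x y, and these are
  roots of unity of order dividing 3 m. Hence x and y preserve a nonzero module L over a subring
  whose size is bounded in terms of p and m. Since x, y and -1 generate all transvections, moving
  one vector of L by the transvections in a fixed direction gives at least q elements of L, so q is
  bounded.
\<close>

section \<open>Symplectic maps of order three\<close>

text \<open>Behind the rigidity, outside characteristic 3, is a dimension count. The two classes of
  elements of order 3 that occur have dimension 6 in the 10-dimensional group Sp4, so pairs up to
  conjugation depend on 12 - 10 = 2 parameters. The characteristic polynomial of x y is palindromic
  and thus has two free coefficients as well. When a generator has eigenvalues 1, 1, w, w^2,
  explicit invariants of the pair are recovered from these two coefficients by at most one square
  root. The resulting bound is r <= 216 m^2 with m = 2 c, where 216 m^2 = 2 * 3m * 3m * 2 * 6: a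
  quadratic extension for w, two extensions of degree at most 3m for the traces l + 1/l of the
  product, one quadratic extension for the square root, and six generators of L. Passing from c to 2
  c pays for the signs: in PSp4 the relations hold only up to the centre, whose elements are 1 and
  -1.\<close>

definition om :: "'a::field ^ 4 \<Rightarrow> 'a ^ 4 \<Rightarrow> 'a" where
  "om u v = u$1 * v$3 + u$2 * v$4 - u$3 * v$1 - u$4 * v$2"

lemma om_add_left: "om (u + v) t = om u t + om v t"
  and om_add_right: "om t (u + v) = om t u + om t v"
  and om_diff_left: "om (u - v) t = om u t - om v t"
  and om_diff_right: "om t (u - v) = om t u - om t v"
  and om_minus_left: "om (- u) t = - om u t"
  and om_minus_right: "om t (- u) = - om t u"
  and om_scale_left: "om (c *s u) t = c * om u t"
  and om_scale_right: "om t (c *s u) = c * om t u"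
  and om_zero_left: "om 0 t = 0"
  and om_zero_right: "om t 0 = 0"
  and om_self: "om u u = 0"
  by (simp_all add: om_def algebra_simps)

lemmas om_bilinear = om_add_left om_add_right om_diff_left om_diff_right om_minus_left
  om_minus_right om_scale_left om_scale_right om_zero_left om_zero_right om_self

lemma om_swap: "om v u = - om u v"
  by (simp add: om_def algebra_simps)

lemma om_nondegenerate:
  assumes "v \<noteq> 0"
  obtains i where "om v (axis i 1) \<noteq> 0"
proof -
  have "v$1 \<noteq> 0 \<or> v$2 \<noteq> 0 \<or> v$3 \<noteq> 0 \<or> v$4 \<noteq> 0"
    using assms by (auto simp: vec_eq_iff forall_4)
  moreover have "om v (axis 3 1) = v$1" "om v (axis 4 1) = v$2"
    "om v (axis 1 1) = - v$3" "om v (axis 2 1) = - v$4"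
    by (simp_all add: om_def axis_def)
  ultimately show ?thesis
    using that by (metis neg_equal_0_iff_equal)
qed

lemma om_nondegenerate_value:
  assumes "v \<noteq> 0"
  obtains u where "om v u = c"
proof -
  obtain i where i: "om v (axis i 1) \<noteq> 0"
    using om_nondegenerate[OF assms] .
  show ?thesis
    by (rule that[of "(c / om v (axis i 1)) *s axis i 1"]) (use i in \<open>simp add: om_bilinear\<close>)
qed

text \<open>The rows of \<open>A\<close> are the functionals dual to e1, e2, f1, f2, so
  \<open>A ** M = mat 1\<close> is the table of pairings. A left inverse of a square matrix is a
  right inverse, and that is the expansion.\<close>

lemma hyperbolic_expansion:
  fixes e1 e2 f1 f2 v :: "'a::field ^ 4"
  assumes "om e1 f1 = 1" "om e2 f2 = 1" "om e1 e2 = 0" "om e1 f2 = 0" "om e2 f1 = 0" "om f1 f2 = 0"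
  shows "v = om v f1 *s e1 + om e1 v *s f1 + om v f2 *s e2 + om e2 v *s f2"
proof -
  define b where "b j = (if j = 1 then e1 else if j = 2 then e2 else if j = 3 then f1 else f2)" for j :: 4
  define M :: "'a^4^4" where "M = (\<chi> i j. b j $ i)"
  define A :: "'a^4^4" where
    "A = (\<chi> i j. om (if i = 1 then axis j 1 else if i = 2 then axis j 1 else if i = 3 then e1 else e2)
                    (if i = 1 then f1 else if i = 2 then f2 else axis j 1))"
  have "A ** M = (\<chi> i j. om (if i = 1 then b j else if i = 2 then b j else if i = 3 then e1 else e2)
                    (if i = 1 then f1 else if i = 2 then f2 else b j))"
    by (simp add: vec_eq_iff forall_4 matrix_matrix_mult_def sum_4 A_def M_def om_def axis_def
        algebra_simps)
  also have "\<dots> = mat 1"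
    using assms om_swap[of f1 e2] om_swap[of f2 e1] om_swap[of e1 e2] om_swap[of f1 f2] om_swap[of e1 f1]
      om_swap[of e2 f2]
    by (simp add: vec_eq_iff forall_4 mat_def b_def om_self)
  finally have "A ** M = mat 1" .
  then have "M ** A = mat 1"
    by (simp add: matrix_left_right_inverse)
  then have "v = M *v (A *v v)"
    by (simp add: matrix_vector_mul_assoc)
  also have "\<dots> = om v f1 *s e1 + om e1 v *s f1 + om v f2 *s e2 + om e2 v *s f2"
    by (simp add: vec_eq_iff forall_4 matrix_vector_mult_def sum_4 A_def M_def b_def om_def axis_def
        algebra_simps)
  finally show ?thesis .
qed

definition symp_map :: "('a::field ^ 4 \<Rightarrow> 'a ^ 4) \<Rightarrow> bool" where
  "symp_map x \<longleftrightarrow> (\<forall>u v. x (u + v) = x u + x v) \<and> (\<forall>c u. x (c *s u) = c *s x u) \<and>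
     (\<forall>u v. om (x u) (x v) = om u v)"

lemma symp_map_linear:
  assumes "symp_map x"
  shows "x (u + v) = x u + x v" "x (c *s u) = c *s x u" "x (u - v) = x u - x v" "x (- u) = - x u" "x 0 = 0"
proof -
  show add: "x (u + v) = x u + x v" and scale: "x (c *s u) = c *s x u" for u v c
    using assms by (auto simp: symp_map_def)
  show minus: "x (- u) = - x u" for u
    using scale[of "-1" u] by simp
  show "x (u - v) = x u - x v"
    using add[of u "- v"] by (simp add: minus)
  show "x 0 = 0"
    using scale[of 0 0] by simp
qed

lemma symp_map_om: "symp_map x \<Longrightarrow> om (x u) (x v) = om u v"
  by (simp add: symp_map_def)

lemma symp_map_comp: "symp_map x \<Longrightarrow> symp_map Y \<Longrightarrow> symp_map (x \<circ> Y)"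
  by (simp add: symp_map_def)

locale symp3 =
  fixes x :: "'a::field ^ 4 \<Rightarrow> 'a ^ 4"
  assumes symp: "symp_map x" and cube: "x (x (x v)) = v"
begin

lemmas lin = symp_map_linear[OF symp]

lemma om_invariant: "om (x u) (x v) = om u v"
  using symp by (rule symp_map_om)

lemma om_adjoint: "om (x u) v = om u (x (x v))" "om u (x v) = om (x (x u)) v"
  using om_invariant[of u "x (x v)"] om_invariant[of "x (x u)" v] by (simp_all add: cube)

lemma om_eigen_zero:
  assumes "x u = a *s u" "x v = b *s v" "a * b \<noteq> 1"
  shows "om u v = 0"
proof -
  have "a * b * om u v = om u v"
    using om_invariant[of u v] assms by (simp add: om_bilinear mult_ac)
  then have "(a * b - 1) * om u v = 0"
    by (simp add: algebra_simps)
  then show ?thesis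
    using assms by simp
qed

text \<open>The form pairs the eigenspace of a with that of 1/a = a^2. Here f is 3 times the
  projection of v to the latter; its three terms pair equally with e, hence the value 1/3.\<close>

lemma dual_eigenvector:
  assumes "x e = a *s e" "a * a * a = 1" "e \<noteq> 0" "(3::'a) \<noteq> 0"
  obtains f where "x f = (a * a) *s f" "om e f = 1"
proof -
  obtain v where v: "om e v = 1/3"
    using om_nondegenerate_value[OF assms(3)] .
  define t :: 'a where "t = 1/3"
  have t: "om e v = t" "t + t + t = 1"
    using assms(4) v by (simp_all add: t_def field_simps)
  define f where "f = v + a *s x v + (a * a) *s x (x v)"
  have "x f = x v + a *s x (x v) + (a * a) *s v"
    by (simp add: f_def lin cube)
  also have "\<dots> = (a * a) *s f"
    using assms(2) by (simp add: f_def vec_eq_iff) Groebner_Basis.algebra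
  finally have 1: "x f = (a * a) *s f" .
  have "a * om e (x v) = om (x e) (x v)"
    using assms(1) by (simp add: om_bilinear)
  then have *: "a * om e (x v) = t"
    using t om_invariant by simp
  have "a * a * om e (x (x v)) = a * om (x e) (x (x v))"
    using assms(1) by (simp add: om_bilinear)
  then have **: "a * a * om e (x (x v)) = t"
    using * om_invariant by simp
  have "om e f = t + t + t"
    using t(1) * ** by (simp add: f_def om_bilinear)
  also have "\<dots> = 1"
    by (rule t(2))
  finally show ?thesis
    using that 1 by blast
qed

end

definition quad_map :: "('a::field ^ 4 \<Rightarrow> 'a ^ 4) \<Rightarrow> bool" where
  "quad_map x \<longleftrightarrow> (\<forall>v. x (x v) = - x v - v)"

lemma quad_map_iff: "quad_map x \<longleftrightarrow> (\<forall>v. x (x v) + x v + v = 0)"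
proof -
  have "a = - b - c \<longleftrightarrow> a + b + c = 0" for a b c :: "'a ^ 4"
    using eq_neg_iff_add_eq_0[of a "b + c"] by (simp add: add.assoc)
  then show ?thesis
    by (simp add: quad_map_def)
qed

text \<open>The maps with eigenvalues 1, 1, w, w^2; the vectors e and f are the eigenvectors for w and w^2.\<close>

definition refl_map :: "'a \<Rightarrow> 'a ^ 4 \<Rightarrow> 'a ^ 4 \<Rightarrow> ('a::field ^ 4 \<Rightarrow> 'a ^ 4) \<Rightarrow> bool" where
  "refl_map w e f x \<longleftrightarrow> om e f = 1 \<and>
     (\<forall>v. x v = v + ((w - 1) * om v f) *s e + ((w * w - 1) * om e v) *s f)"

context symp3
begin

text \<open>In characteristic 3 put E = x^2 + x + 1 = (x - 1)^2. The form om (E u) v is alternating of rank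
  at most 1, hence zero.\<close>

lemma quad_map_char3:
  assumes "(3::'a) = 0"
  shows "quad_map x"
proof (rule ccontr)
  assume "\<not> quad_map x"
  define E where "E v = x (x v) + x v + v" for v
  obtain u where "E u \<noteq> 0"
    using \<open>\<not> quad_map x\<close> by (auto simp: quad_map_iff E_def)
  then obtain v where v: "om (E u) v = 1"
    by (rule om_nondegenerate_value)
  have adj: "om (E s) t = om s (E t)" for s t
    using om_adjoint(1)[of s t] om_adjoint(2)[of s t] by (simp add: E_def om_bilinear)
  have XE: "x (E s) = E s" for s
    by (simp add: E_def lin cube algebra_simps)
  have E0: "E (x s - s) = 0" for s
    by (simp add: E_def lin cube)
  have EE: "E (E s) = 0" for s
  proof -
    have "E (E s) = 3 *s E s"
      unfolding E_def[of "E s"] XE by (simp add: vec_eq_iff)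
    then show ?thesis
      using assms by simp
  qed
  have two: "(2::'a) \<noteq> 0"
  proof
    assume "(2::'a) = 0"
    moreover have "(1::'a) = 3 - 2"
      by simp
    ultimately show False
      using assms by (simp only: diff_self one_neq_zero)
  qed
  have alt: "om (E s) s = 0" for s
  proof -
    have "om (E s) s + om (E s) s = 0"
      using adj[of s s] om_swap[of "E s" s] by simp
    then show ?thesis
      using two by (metis mult_2 mult_eq_0_iff)
  qed
  \<comment> \<open>The correction makes u' orthogonal to v, and E u' = E u because E^2 = 0. So (E
    u, v) and (u', E v) are orthogonal hyperbolic pairs.\<close>
  define u' where "u' = u + om v u *s E u"
  have Eu': "E u' = E u"
  proof -
    have "E u' = E u + om v u *s E (E u)"
      unfolding u'_def E_def by (simp add: lin vec_eq_iff algebra_simps)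
    then show ?thesis
      by (simp add: EE)
  qed
  have h: "x u - u = om (x u - u) v *s E u + om (E u) (x u - u) *s v
      + om (x u - u) (E v) *s u' + om u' (x u - u) *s E v"
  proof (rule hyperbolic_expansion)
    show "om (E u) v = 1" by (rule v)
    show "om u' (E v) = 1"
      by (simp add: adj[symmetric] Eu' v)
    show "om (E u) u' = 0"
      by (simp add: u'_def om_bilinear alt)
    show "om (E u) (E v) = 0"
      by (simp add: adj EE om_bilinear flip: adj[of "E u"])
    show "om u' v = 0"
      using v om_swap[of u v] by (simp add: u'_def om_bilinear)
    show "om v (E v) = 0"
      using alt[of v] om_swap[of v "E v"] by simp
  qed
  \<comment> \<open>E is self-adjoint and kills the image of x - 1. So x u - u is a combination of E
    u and E v, which x fixes; then x^2 u = 2 x u - u, that is, E u = 3 x u.\<close>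
  have "om (x u - u) (E v) = 0" "om (E u) (x u - u) = 0"
    unfolding adj[of u] adj[of "x u - u" v, symmetric] E0 by (rule om_bilinear)+
  then have "x (x u - u) = x u - u"
    using arg_cong[OF h, of x] h by (simp only: lin XE vector_smult_lzero add_0_right)
  then have "E u = 3 *s x u"
    by (simp add: E_def lin vec_eq_iff algebra_simps)
  then show False
    using assms \<open>E u \<noteq> 0\<close> by simp
qed

text \<open>As x^2 + x + 1 is not zero, 1 is an eigenvalue, and duality gives a hyperbolic plane of
  fixed vectors. As x is not the identity, w or w^2 is an eigenvalue, hence by duality both are. The
  two planes fill the space.\<close>

lemma classification:
  assumes "(3::'a) \<noteq> 0" "w * w + w + 1 = 0" "\<not> quad_map x" "x \<noteq> id"
  obtains e f where "refl_map w e f x"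
proof -
  have w3: "w * w * w = 1"
    using assms(2) by Groebner_Basis.algebra
  have w1: "w \<noteq> 1" and ww1: "w * w \<noteq> 1"
    using assms(1,2) w3 by auto
  obtain s where s: "x (x s) + x s + s \<noteq> 0"
    using \<open>\<not> quad_map x\<close> by (auto simp: quad_map_iff)
  define g where "g = x (x s) + x s + s"
  have Xg: "x g = 1 *s g"
    by (simp add: g_def lin cube algebra_simps)
  obtain h where Xh: "x h = 1 *s h" and gh: "om g h = 1"
    using dual_eigenvector[OF Xg] s assms(1) by (auto simp: g_def)
  obtain e where e: "x e = w *s e" "e \<noteq> 0"
  proof -
    obtain t where t: "x t \<noteq> t"
      using \<open>x \<noteq> id\<close> by (auto simp: fun_eq_iff)
    \<comment> \<open>Multiples of the projections of t to the eigenspaces of w and w^2. They cannot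
      both vanish, since t is not fixed.\<close>
    define t1 where "t1 = t + (w * w) *s x t + w *s x (x t)"
    define t2 where "t2 = t + w *s x t + (w * w) *s x (x t)"
    have X1: "x t1 = w *s t1"
      using w3 by (simp add: t1_def lin cube vec_eq_iff) Groebner_Basis.algebra
    have X2: "x t2 = (w * w) *s t2"
      using w3 by (simp add: t2_def lin cube vec_eq_iff) Groebner_Basis.algebra
    show ?thesis
    proof (cases "t1 = 0")
      case False
      then show ?thesis using X1 that by blast
    next
      case True
      have "t2 \<noteq> 0"
      proof
        assume "t2 = 0"
        have "(w - w * w) * (x t $ i - x (x t) $ i) = t2$i - t1$i" for i
          by (simp add: t1_def t2_def algebra_simps)
        then have "(w - w * w) * (x t $ i - x (x t) $ i) = 0" for i
          using True \<open>t2 = 0\<close> by simp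
        moreover have "w - w * w \<noteq> 0"
          using w1 w3 by auto
        ultimately have *: "x t $ i = x (x t) $ i" for i
          by simp
        then have "x t = x (x t)"
          by (simp add: vec_eq_iff)
        then have "x (x t) = t"
          by (metis cube)
        then show False
          using \<open>x t = x (x t)\<close> t by simp
      qed
      then obtain e where "x e = (w * w * (w * w)) *s e" "om t2 e = 1"
        using dual_eigenvector[OF X2] w3 assms(1) by (metis mult.assoc mult_1)
      moreover have "w * w * (w * w) = w"
        using w3 by (simp add: mult.assoc)
      ultimately show ?thesis
        using that by (metis om_zero_right zero_neq_one)
    qed
  qed
  then obtain f where f: "x f = (w * w) *s f" "om e f = 1"
    using dual_eigenvector w3 assms(1) by metis
  have z: "om e g = 0" "om e h = 0" "om g f = 0" "om f h = 0"
    using om_eigen_zero[OF e(1) Xg] om_eigen_zero[OF e(1) Xh] om_eigen_zero[OF Xg f(1)]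
      om_eigen_zero[OF f(1) Xh] w1 ww1 by simp_all
  have "x v = v + ((w - 1) * om v f) *s e + ((w * w - 1) * om e v) *s f" for v
  proof -
    have v: "v = om v f *s e + om e v *s f + om v h *s g + om g v *s h"
      by (rule hyperbolic_expansion) (use z f gh in auto)
    have "x v = om v f *s x e + om e v *s x f + om v h *s x g + om g v *s x h"
      by (subst v) (simp only: lin)
    also have "\<dots> = v + ((w - 1) * om v f) *s e + ((w * w - 1) * om e v) *s f"
      by (subst (4) v) (simp add: e f Xg Xh vec_eq_iff algebra_simps)
    finally show ?thesis .
  qed
  then show ?thesis
    using that f(2) unfolding refl_map_def by blast
qed

end

section \<open>Small subrings and their lattices\<close>

definition subring_set :: "'a::comm_ring_1 set \<Rightarrow> bool" where
  "subring_set k \<longleftrightarrow> 1 \<in> k \<and> (\<forall>a\<in>k. - a \<in> k) \<and> (\<forall>a\<in>k. \<forall>b\<in>k. a + b \<in> k \<and> a * b \<in> k)"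

lemma subring_setD:
  assumes "subring_set k"
  shows "1 \<in> k" "0 \<in> k" "a \<in> k \<Longrightarrow> - a \<in> k" "a \<in> k \<Longrightarrow> b \<in> k \<Longrightarrow> a + b \<in> k"
    "a \<in> k \<Longrightarrow> b \<in> k \<Longrightarrow> a - b \<in> k" "a \<in> k \<Longrightarrow> b \<in> k \<Longrightarrow> a * b \<in> k" "a \<in> k \<Longrightarrow> a ^ n \<in> k"
    "numeral q \<in> k"
proof -
  show m: "- a \<in> k" if "a \<in> k" for a
    using assms that by (auto simp: subring_set_def)
  show add: "a + b \<in> k" and mult: "a * b \<in> k" if "a \<in> k" "b \<in> k" for a b
    using assms that by (auto simp: subring_set_def)
  show one: "1 \<in> k"
    using assms by (simp add: subring_set_def)
  show "0 \<in> k"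
    using add[OF one m[OF one]] by simp
  show "a \<in> k \<Longrightarrow> b \<in> k \<Longrightarrow> a - b \<in> k"
    using add[OF _ m] by (metis diff_conv_add_uminus)
  show "a \<in> k \<Longrightarrow> a ^ n \<in> k"
    by (induction n) (auto intro: one mult)
  show "numeral q \<in> k"
    by (induction q) (auto simp only: numeral.simps intro!: one add)
qed

text \<open>Horner form of the values at t of the polynomials of degree less than n over k.\<close>

fun poly_values :: "'a::comm_ring_1 set \<Rightarrow> 'a \<Rightarrow> nat \<Rightarrow> 'a set" where
  "poly_values k t 0 = {0}"
| "poly_values k t (Suc n) = (\<lambda>(a, s). a + t * s) ` (k \<times> poly_values k t n)"

context
  fixes k :: "'a::comm_ring_1 set" and t :: 'a
  assumes k: "subring_set k"
begin

lemma poly_values_SucI: "a \<in> k \<Longrightarrow> s \<in> poly_values k t n \<Longrightarrow> a + t * s \<in> poly_values k t (Suc n)"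
  by auto

lemma poly_values_add:
  "s \<in> poly_values k t n \<Longrightarrow> r \<in> poly_values k t n \<Longrightarrow> s + r \<in> poly_values k t n"
proof (induction n arbitrary: s r)
  case (Suc n)
  then obtain a s' b r' where *: "s = a + t * s'" "r = b + t * r'" "a \<in> k" "b \<in> k"
    "s' \<in> poly_values k t n" "r' \<in> poly_values k t n"
    by auto
  have "s + r = (a + b) + t * (s' + r')"
    by (simp add: * algebra_simps)
  then show ?case
    using poly_values_SucI[OF subring_setD(4)[OF k *(3,4)] Suc.IH[OF *(5,6)]] by simp
qed simp

lemma poly_values_scale: "a \<in> k \<Longrightarrow> s \<in> poly_values k t n \<Longrightarrow> a * s \<in> poly_values k t n"
proof (induction n arbitrary: s)
  case (Suc n)
  then obtain b s' where *: "s = b + t * s'" "b \<in> k" "s' \<in> poly_values k t n"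
    by auto
  have "a * s = a * b + t * (a * s')"
    by (simp add: * algebra_simps)
  then show ?case
    using poly_values_SucI[OF subring_setD(6)[OF k Suc.prems(1) *(2)] Suc.IH[OF Suc.prems(1) *(3)]]
    by simp
qed simp

text \<open>The recursion splits off the constant term, whereas rewriting t^n calls for the top
  coefficient.\<close>

lemma poly_values_leading:
  "s \<in> poly_values k t (Suc n) \<Longrightarrow> \<exists>r\<in>poly_values k t n. \<exists>c\<in>k. s = r + c * t ^ n"
proof (induction n arbitrary: s)
  case (Suc n)
  then obtain a s' where *: "s = a + t * s'" "a \<in> k" "s' \<in> poly_values k t (Suc n)"
    by (auto simp only: poly_values.simps(2)[of _ _ "Suc n"])
  obtain r c where r: "r \<in> poly_values k t n" "c \<in> k" "s' = r + c * t ^ n"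
    using Suc.IH[OF *(3)] by blast
  have "s = (a + t * r) + c * t ^ Suc n"
    by (simp add: * r algebra_simps)
  then show ?case
    using poly_values_SucI[OF *(2) r(1)] r(2) by blast
qed auto

lemma card_poly_values: 
  assumes "finite k"
  shows "finite (poly_values k t n) \<and> card (poly_values k t n) \<le> card k ^ n"
proof (induction n)
  case (Suc n)
  then have "card (poly_values k t (Suc n)) \<le> card (k \<times> poly_values k t n)"
    using assms by (simp only: poly_values.simps card_image_le finite_cartesian_product)
  also have "\<dots> \<le> card k ^ Suc n"
    using Suc by (simp add: card_cartesian_product)
  finally show ?case
    using Suc assms by auto
qed simp

text \<open>Since t^n folds back into lower powers, the polynomials of degree less than n already
  give all of k[t], and there are at most |k|^n coefficient tuples.\<close>

lemma adjoin_integral_element: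
  assumes "finite k" "n > 0" "t ^ n \<in> poly_values k t n"
  obtains k' where "subring_set k'" "finite k'" "k \<subseteq> k'" "t \<in> k'" "card k' \<le> card k ^ n"
proof -
  let ?R = "poly_values k t n"
  have sub: "poly_values k t (Suc n) \<subseteq> ?R"
    using poly_values_leading poly_values_add poly_values_scale assms(3) by fast
  have zero: "0 \<in> poly_values k t j" for j
  proof (induction j)
    case (Suc j)
    then show ?case
      using poly_values_SucI[OF subring_setD(2)[OF k]] by force
  qed simp
  have tmult: "s \<in> ?R \<Longrightarrow> t * s \<in> ?R" for s
    using poly_values_SucI[OF subring_setD(2)[OF k], of s n] sub by auto
  have kR: "a \<in> ?R" if "a \<in> k" for a
    using poly_values_SucI[OF that zero, of n] sub by auto
  have mult: "s \<in> poly_values k t j \<Longrightarrow> r \<in> ?R \<Longrightarrow> s * r \<in> ?R" for s r j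
  proof (induction j arbitrary: s)
    case 0
    then show ?case
      using zero by simp
  next
    case (Suc j)
    then obtain a s' where *: "s = a + t * s'" "a \<in> k" "s' \<in> poly_values k t j"
      by auto
    have "s * r = a * r + t * (s' * r)"
      by (simp add: * algebra_simps)
    then show ?case
      using poly_values_add[OF poly_values_scale[OF *(2) Suc.prems(2)] tmult[OF Suc.IH[OF *(3) Suc.prems(2)]]]
      by simp
  qed
  have one: "1 \<in> ?R" "-1 \<in> ?R"
    by (auto intro: kR subring_setD[OF k])
  have "subring_set ?R"
    using one mult[OF one(2)] mult poly_values_add by (simp add: subring_set_def)
  moreover have "t \<in> ?R"
    using tmult[OF one(1)] by simp
  ultimately show ?thesis
    using that card_poly_values[OF assms(1), of n] kR by blast
qed

lemma adjoin_root_of_unity: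
  assumes "finite k" "n > 0" "t ^ n = 1"
  obtains k' where "subring_set k'" "finite k'" "k \<subseteq> k'" "t \<in> k'" "card k' \<le> card k ^ n"
proof -
  have "0 \<in> poly_values k t j" for j
    by (induction j) (use subring_setD(2)[OF k] in force)+
  then have "1 + t * 0 \<in> poly_values k t (Suc (n - 1))"
    by (intro poly_values_SucI subring_setD[OF k])
  then have "t ^ n \<in> poly_values k t n"
    using assms by simp
  then show ?thesis
    using adjoin_integral_element[OF assms(1,2)] that by blast
qed

lemma adjoin_quadratic:
  assumes "finite k" "a \<in> k" "b \<in> k" "t * t + a * t + b = 0"
  obtains k' where "subring_set k'" "finite k'" "k \<subseteq> k'" "t \<in> k'" "card k' \<le> card k ^ 2"
proof -
  have "t ^ 2 = - b + t * (- a + t * 0)"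
    using assms(4) by (simp add: power2_eq_square algebra_simps add_eq_0_iff)
  moreover have "- b + t * (- a + t * 0) \<in> poly_values k t (Suc (Suc 0))"
    by (intro poly_values_SucI subring_setD[OF k] assms) simp
  ultimately have "t ^ 2 \<in> poly_values k t 2"
    by (simp only: numeral_2_eq_2)
  then show ?thesis
    using adjoin_integral_element[OF assms(1)] that by (metis zero_less_numeral)
qed

end

section \<open>Modules spanned by finitely many vectors over a subring\<close>

fun module_span :: "'a::field set \<Rightarrow> ('a ^ 4) list \<Rightarrow> ('a ^ 4) set" where
  "module_span k [] = {0}"
| "module_span k (b # bs) = (\<lambda>(c, s). c *s b + s) ` (k \<times> module_span k bs)"

text \<open>Coefficient tuples are counted, so the generators may be dependent or zero.\<close>

lemma card_module_span:
  assumes "finite k"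
  shows "finite (module_span k bs) \<and> card (module_span k bs) \<le> card k ^ length bs"
proof (induction bs)
  case (Cons b bs)
  then have "card (module_span k (b # bs)) \<le> card (k \<times> module_span k bs)"
    using assms by (simp only: module_span.simps card_image_le finite_cartesian_product)
  also have "\<dots> \<le> card k ^ length (b # bs)"
    using Cons by (simp add: card_cartesian_product)
  finally show ?case
    using Cons assms by auto
qed simp

context
  fixes k :: "'a::field set"
  assumes k: "subring_set k"
begin

lemma module_span_ConsI: "c \<in> k \<Longrightarrow> s \<in> module_span k bs \<Longrightarrow> c *s b + s \<in> module_span k (b # bs)"
  by auto

lemma module_span_add: "s \<in> module_span k bs \<Longrightarrow> r \<in> module_span k bs \<Longrightarrow> s + r \<in> module_span k bs"
proof (induction bs arbitrary: s r)
  case (Cons b bs)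
  then obtain a s' c r' where *: "s = a *s b + s'" "r = c *s b + r'" "a \<in> k" "c \<in> k"
    "s' \<in> module_span k bs" "r' \<in> module_span k bs"
    by auto
  have "s + r = (a + c) *s b + (s' + r')"
    by (simp add: * algebra_simps vec_eq_iff)
  then show ?case
    using module_span_ConsI[OF subring_setD(4)[OF k *(3,4)] Cons.IH[OF *(5,6)]] by simp
qed simp

lemma module_span_scale: "a \<in> k \<Longrightarrow> s \<in> module_span k bs \<Longrightarrow> a *s s \<in> module_span k bs"
proof (induction bs arbitrary: s)
  case (Cons b bs)
  then obtain c s' where *: "s = c *s b + s'" "c \<in> k" "s' \<in> module_span k bs"
    by auto
  have "a *s s = (a * c) *s b + a *s s'"
    by (simp add: * algebra_simps vec_eq_iff)
  then show ?case
    using module_span_ConsI[OF subring_setD(6)[OF k Cons.prems(1) *(2)] Cons.IH[OF Cons.prems(1) *(3)]]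
    by simp
qed simp

lemma module_span_minus: "s \<in> module_span k bs \<Longrightarrow> - s \<in> module_span k bs"
  using module_span_scale[of "-1" s bs] subring_setD[OF k] by simp

lemma module_span_diff: "s \<in> module_span k bs \<Longrightarrow> r \<in> module_span k bs \<Longrightarrow> s - r \<in> module_span k bs"
  using module_span_add[OF _ module_span_minus, of s bs r] by simp

lemma module_span_zero: "0 \<in> module_span k bs"
  by (induction bs) (use subring_setD(2)[OF k] in force)+

lemma module_span_gen: "b \<in> set bs \<Longrightarrow> b \<in> module_span k bs"
proof (induction bs)
  case (Cons c bs)
  show ?case
  proof (cases "b = c")
    case True
    then show ?thesis
      using module_span_ConsI[OF subring_setD(1)[OF k] module_span_zero, of b bs] by simp
  next
    case False
    then show ?thesis
      using module_span_ConsI[OF subring_setD(2)[OF k], of b bs c] Cons by simp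
  qed
qed simp

lemma module_span_invariant:
  assumes "symp_map x" "\<And>b. b \<in> set bs \<Longrightarrow> x b \<in> module_span k bs" "s \<in> module_span k bs"
  shows "x s \<in> module_span k bs"
proof -
  have "s \<in> module_span k cs \<Longrightarrow> set cs \<subseteq> set bs \<Longrightarrow> x s \<in> module_span k bs" for cs
  proof (induction cs arbitrary: s)
    case Nil
    then show ?case
      using module_span_zero symp_map_linear(5)[OF assms(1)] by simp
  next
    case (Cons c cs)
    then obtain a s' where *: "s = a *s c + s'" "a \<in> k" "s' \<in> module_span k cs"
      by auto
    then show ?case
      using Cons assms(2)[of c] by (auto simp: symp_map_linear[OF assms(1)] intro!: module_span_add module_span_scale)
  qed
  then show ?thesis
    using assms(3) by blast
qed

end

lemma quadratic_root_exists: "\<exists>t::'a::alg_closed_field. t * t + b * t + c = 0"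
proof -
  obtain t where "poly [:c, b, 1:] t = 0"
    using alg_closed_imp_poly_has_root[of "[:c, b, 1:]"] by auto
  then show ?thesis
    by (intro exI[of _ t]) (simp add: algebra_simps)
qed

lemma singular_2x2_kernel:
  fixes a b c d :: "'a::field"
  assumes "a * d - b * c = 0"
  obtains s t where "a * s + b * t = 0" "c * s + d * t = 0" "s \<noteq> 0 \<or> t \<noteq> 0"
proof (cases "a = 0 \<and> b = 0")
  case True
  show ?thesis
  proof (cases "c = 0 \<and> d = 0")
    case True
    then show ?thesis
      using \<open>a = 0 \<and> b = 0\<close> that[of 1 0] by simp
  next
    case False
    then show ?thesis
      using True that[of d "- c"] by (auto simp: algebra_simps)
  qed
next
  case False
  then show ?thesis
    using assms that[of "- b" a] by (auto simp: algebra_simps)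
qed

declare module_span.simps [simp del]

section \<open>Generators of the symplectic group\<close>

definition transvection :: "'a::field \<Rightarrow> 'a ^ 4 \<Rightarrow> 'a ^ 4 \<Rightarrow> 'a ^ 4" where
  "transvection a u v = v + (a * om v u) *s u"

text \<open>Commuting with the transvection along u makes u an eigenvector of C, and the eigenvalue
  carries over to u from an eigenvector that pairs with u. This links axes 1 and 3, and axes 2 and
  4; the vector \<open>axis 1 1 + axis 2 1\<close> links the two planes.\<close>

lemma transvection_commuting_is_scalar:
  fixes C :: "'a::field ^ 4 \<Rightarrow> 'a ^ 4"
  assumes add: "\<And>u v. C (u + v) = C u + C v" and scale: "\<And>c u. C (c *s u) = c *s C u"
    and comm_transvection: "\<And>u v. (\<And>i. u $ i \<in> {0, 1}) \<Longrightarrow> C (transvection 1 u v) = transvection 1 u (C v)"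
  obtains c where "\<And>v. C v = c *s v"
proof -
  have comm: "om v u *s C u = om (C v) u *s u" if "\<And>i. u $ i \<in> {0, 1}" for u v :: "'a ^ 4"
    using comm_transvection[OF that, of v] by (simp add: transvection_def add scale)
  have ax: "(axis i (1::'a) :: 'a ^ 4) $ j = (if j = i then 1 else 0)" for i j
    by (simp add: axis_def)
  have om_axis: "om v (axis 1 1) = - v$3" "om v (axis 3 1) = v$1" "om v (axis 4 1) = v$2"
    "om v (axis 1 1 + axis 2 1) = - v$3 - v$4" for v :: "'a ^ 4"
    by (simp_all add: om_def ax)
  have comm_axis: "om v (axis i 1) *s C (axis i 1) = om (C v) (axis i 1) *s axis i 1" for v i
    by (rule comm) (simp add: ax)
  define c where "c = C (axis 1 1) $ 1"
  have C3: "C (axis 3 1) = c *s axis 3 1"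
    using comm_axis[of "axis 1 1" 3] by (simp add: om_axis ax c_def)
  have C1: "C (axis 1 1) = c *s axis 1 1"
    using comm_axis[of "axis 3 1" 1] by (simp add: om_axis ax C3)
  have "om v (axis 1 1 + axis 2 1) *s C (axis 1 1 + axis 2 1)
      = om (C v) (axis 1 1 + axis 2 1) *s (axis 1 1 + axis 2 1)" for v
    by (rule comm) (simp add: ax)
  from this[of "axis 3 1"] have "C (axis 1 1 + axis 2 1) = c *s (axis 1 1 + axis 2 1)"
    by (simp add: om_axis ax C3)
  then have C2: "C (axis 2 1) = c *s axis 2 1"
    by (simp add: add C1 vec.scale_right_distrib)
  have C4: "C (axis 4 1) = c *s axis 4 1"
    using comm_axis[of "axis 2 1" 4] by (simp add: om_axis ax C2)
  have "C v = c *s v" for v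
  proof -
    have v: "v = v$1 *s axis 1 1 + v$2 *s axis 2 1 + v$3 *s axis 3 1 + v$4 *s axis 4 1"
      by (simp add: vec_eq_iff forall_4 ax)
    have "C v = v$1 *s C (axis 1 1) + v$2 *s C (axis 2 1) + v$3 *s C (axis 3 1) + v$4 *s C (axis 4 1)"
      by (subst v) (simp only: add scale)
    also have "\<dots> = c *s v"
      by (simp add: C1 C2 C3 C4 vec_eq_iff forall_4 ax)
    finally show ?thesis .
  qed
  then show ?thesis
    using that by blast
qed

text \<open>The left-hand side is the determinant in \<open>eigenvalue_of_determinant\<close> below. The last factor
  on the right is the characteristic polynomial of the product of the two generators; it is
  palindromic in l, so it depends only on the trace t = l + 1 / l and is quadratic in t.\<close>

lemma determinant_factors_quad:
  fixes w A l d T :: "'a::field"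
  assumes "w * w + w + 1 = 0" "T = w + (w - w * w) * A"
  shows "(l * l * l - 1 - (w - 1) * (l * l * A + l * (- 1 - A) + 1))
      * (l * l * l - 1 - (w * w - 1) * (l * l * (- 1 - A) + l * A + 1))
      + 3 * d * (l * l) * ((l - 1) * (l - 1))
    = (l - 1) * (l - 1) * ((l * l + 1) * (l * l + 1) - T * l * (l * l + 1) + (T * T - 3 + 3 * d) * (l * l))"
  using assms by Groebner_Basis.algebra

text \<open>The other factor on the right, here l^2 + l + 1 and above (l - 1)^2, is (l^3 - 1)^2
  divided by the characteristic polynomial of y.\<close>

lemma determinant_factors_refl:
  fixes w u s l d A B :: "'a::field"
  assumes "w * w + w + 1 = 0" "A = 1 - (w - 1) * s + (w * w - 1) * u" "B = 1 - (w * w - 1) * s + (w - 1) * u"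
  shows "(l * l * l - 1 - (w - 1) * (l * l * A + l * B + 1))
      * (l * l * l - 1 - (w * w - 1) * (l * l * B + l * A + 1))
      + 3 * (- 3 * u * s) * (l * l) * ((l - 1) * (l - 1))
    = (l * l + l + 1) * ((l * l + 1 + l) * (l * l + 1 + l) - 6 * u * l * (l * l + 1 + l)
      + 3 * s * l * (l * l + 1 + 4 * l) + 9 * (u - s) * (u - s) * l * l)"
  using assms by Groebner_Basis.algebra

text \<open>Generation is an induction principle over sets S of maps, to be applied to stabilisers
  and centralisers. Closure under composition suffices because inverses in a finite group are
  powers. Vectors with coordinates 0 and 1 lie over every subfield.\<close>

locale sp4_generators = x: symp3 x + y: symp3 y
  for x y :: "'a::alg_closed_field ^ 4 \<Rightarrow> 'a ^ 4" +
  fixes F :: "'a set" and m :: nat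
  assumes order: "((x \<circ> y) ^^ m) v = v" and m_pos: "m > 0" and one_F: "1 \<in> F"
    and generate_transvections: "\<And>S a u. \<lbrakk>x \<in> S; y \<in> S; uminus \<in> S;
      \<And>f g. f \<in> S \<Longrightarrow> g \<in> S \<Longrightarrow> f \<circ> g \<in> S; a \<in> F; \<And>i. u $ i \<in> {0, 1}\<rbrakk> \<Longrightarrow> transvection a u \<in> S"
begin

lemma swap: "sp4_generators y x F m"
proof unfold_locales
  have "x (((y \<circ> x) ^^ n) v) = ((x \<circ> y) ^^ n) (x v)" for n v
    by (induction n) auto
  then have "x (((y \<circ> x) ^^ m) v) = x v" for v
    by (simp add: order)
  then show "((y \<circ> x) ^^ m) v = v" for v
    by (metis x.cube)
qed (use m_pos one_F generate_transvections in blast)+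

lemma eigenvalue_order:
  assumes "x (y v) = l *s v" "v \<noteq> 0"
  shows "l ^ m = 1"
proof -
  have "((x \<circ> y) ^^ n) v = l ^ n *s v" for n
    by (induction n) (simp_all add: x.lin y.lin assms mult.commute)
  then have "l ^ m *s v = v"
    using order by metis
  then show ?thesis
    using assms(2) by (metis vec.scale_right_imp_eq vector_smult_lid)
qed

lemma card_le_invariant_set:
  assumes "finite L" "v \<in> L" "v \<noteq> 0"
    and "\<And>u. u \<in> L \<Longrightarrow> x u \<in> L" "\<And>u. u \<in> L \<Longrightarrow> y u \<in> L" "\<And>u. u \<in> L \<Longrightarrow> - u \<in> L"
  shows "card F \<le> card L"
proof -
  obtain i where i: "om v (axis i 1) \<noteq> 0"
    using om_nondegenerate[OF assms(3)] .
  have "transvection a (axis i 1) \<in> {g. \<forall>u\<in>L. g u \<in> L}" if "a \<in> F" for a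
    by (rule generate_transvections) (use assms that in \<open>auto simp: axis_def\<close>)
  then have "(\<lambda>a. transvection a (axis i 1) v) ` F \<subseteq> L"
    using assms(2) by auto
  moreover have "inj_on (\<lambda>a. transvection a (axis i 1) v) F"
  proof (rule inj_onI)
    fix a b assume "transvection a (axis i 1) v = transvection b (axis i 1) v"
    then have "transvection a (axis i 1) v $ i = transvection b (axis i 1) v $ i"
      by simp
    then show "a = b"
      using i by (simp add: transvection_def axis_def)
  qed
  ultimately show ?thesis
    using card_inj_on_le assms(1) by blast
qed

text \<open>Schur's lemma, with S taken to be the centraliser of C.\<close>

lemma commuting_map_is_scalar:
  assumes add: "\<And>u v. C (u + v) = C u + C v" and scale: "\<And>c u. C (c *s u) = c *s C u"
    and "\<And>v. C (x v) = x (C v)" "\<And>v. C (y v) = y (C v)"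
  obtains c where "\<And>v. C v = c *s v"
proof (rule transvection_commuting_is_scalar[OF add scale])
  have minus: "C (- v) = - C v" for v
    using scale[of "-1" v] by simp
  show "C (transvection 1 u v) = transvection 1 u (C v)" if "\<And>i. u $ i \<in> {0, 1}" for u v :: "'a ^ 4"
  proof -
    have "transvection 1 u \<in> {g. \<forall>v. C (g v) = g (C v)}"
      by (rule generate_transvections) (use assms that one_F minus in auto)
    then show ?thesis
      by simp
  qed
qed (rule that)

text \<open>Otherwise y commutes with both generators and is scalar, so only scalars are generated;
  a transvection is not one.\<close>

lemma not_id: "x \<noteq> id"
proof
  assume id: "x = id"
  obtain c where c: "y v = c *s v" for v
    by (rule commuting_map_is_scalar[of y]) (auto simp: id y.lin)
  have "transvection (1::'a) (axis 1 1) \<in> {g. \<exists>c. \<forall>v. g v = c *s v}"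
  proof (rule generate_transvections)
    show "x \<in> {g. \<exists>c. \<forall>v. g v = c *s v}"
      by (auto simp: id intro: exI[of _ 1])
    show "uminus \<in> {g. \<exists>c. \<forall>v::'a^4. g v = c *s v}"
      by (auto intro: exI[of _ "-1"])
    show "f \<circ> g \<in> {g. \<exists>c. \<forall>v::'a^4. g v = c *s v}"
      if "f \<in> {g. \<exists>c. \<forall>v::'a^4. g v = c *s v}" "g \<in> {g. \<exists>c. \<forall>v::'a^4. g v = c *s v}" for f g
      using that by auto
  qed (use c one_F in \<open>auto simp: axis_def\<close>)
  then obtain d where "transvection (1::'a) (axis 1 1) (axis 3 1) = d *s axis 3 1"
    by blast
  then have "transvection (1::'a) (axis 1 1) (axis 3 1) $ 1 = (d *s axis 3 1 :: 'a ^ 4) $ 1"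
    by simp
  then show False
    by (simp add: transvection_def om_def axis_def)
qed

text \<open>The sum of the product and its inverse, here written as C, is central. So the product has
  an eigenvector v, and v and y v span an invariant plane.\<close>

lemma card_le_quad_quad:
  fixes k :: "'a set"
  assumes "quad_map x" "quad_map y" "subring_set k" "finite k"
  shows "card F \<le> card k ^ (2 * m)"
proof -
  have qx: "x (x v) = - x v - v" and qy: "y (y v) = - y v - v" for v
    using assms by (auto simp: quad_map_def)
  \<comment> \<open>As y^(-1) = - y - 1 and x^(-1) = - x - 1, the inverse of x y is 1 + x + y + y x,
    so C = x y + (x y)^(-1).\<close>
  define C where "C v = v + x v + y v + x (y v) + y (x v)" for v
  obtain c where c: "C v = c *s v" for v
  proof (rule commuting_map_is_scalar[of C])
    show "C (x v) = x (C v)" "C (y v) = y (C v)" for v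
      by (simp_all add: C_def x.lin y.lin qx qy)
  qed (auto simp: C_def x.lin y.lin vec.scale_right_distrib)
  obtain l where l: "l * l + (- c) * l + 1 = 0"
    using quadratic_root_exists by blast
  have z2: "x (y (x (y v))) = c *s x (y v) - v" for v
  proof -
    have "x (y (C v)) = c *s x (y v)"
      by (simp add: c x.lin y.lin)
    moreover have "x (y (C v)) = x (y (x (y v))) + v"
      by (simp add: C_def x.lin y.lin qx qy)
    ultimately show ?thesis
      by (simp add: eq_diff_eq)
  qed
  define t where "t = c - l"
  have lt: "l * t = 1"
    using l by (simp add: t_def algebra_simps add_eq_0_iff)
  obtain l' v where l': "x (y v) = l' *s v" "v \<noteq> 0"
  proof -
    define v0 :: "'a ^ 4" where "v0 = axis 1 1"
    \<comment> \<open>The product z = x y satisfies (z - l) (z - t) = 0. So either v0 is an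
      eigenvector for t, or its image under z - t is one for l.\<close>
    define v where "v = x (y v0) - t *s v0"
    show ?thesis
    proof (cases "v = 0")
      case True
      then show ?thesis
        using that[of v0 t] by (simp add: v_def v0_def)
    next
      case False
      have "x (y v) = l *s v"
        using lt by (simp add: v_def x.lin y.lin z2 vec_eq_iff t_def algebra_simps)
      then show ?thesis
        using that False by blast
    qed
  qed
  have l'm: "l' ^ m = 1"
    using eigenvalue_order l' by blast
  then obtain k' where k': "subring_set k'" "finite k'" "k \<subseteq> k'" "l' \<in> k'" "card k' \<le> card k ^ m"
    using adjoin_root_of_unity[OF assms(3,4) m_pos] by blast
  let ?L = "module_span k' [v, y v]"
  note span = module_span_add[OF k'(1)] module_span_scale[OF k'(1)] module_span_minus[OF k'(1)]
    module_span_diff[OF k'(1)]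
  have gen: "v \<in> ?L" "y v \<in> ?L"
    using module_span_gen[OF k'(1), of _ "[v, y v]"] by auto
  have inv: "l' * l' ^ (m - 1) = 1"
    using l'm m_pos by (metis power_eq_if not_less0)
  \<comment> \<open>Applying x to x (y v) = l' v gives l' x v; the power l'^(m - 1) is the inverse
    of l' inside k'.\<close>
  have xv: "x v = - v - l' ^ (m - 1) *s y v"
  proof -
    have "l' *s x v = x (x (y v))"
      by (simp add: l' x.lin)
    also have "\<dots> = - (l' *s v) - y v"
      by (simp only: qx[of "y v"]) (simp add: l')
    finally have "l' *s x v = - (l' *s v) - y v" .
    then have "l' ^ (m - 1) *s (l' *s x v) = l' ^ (m - 1) *s (- (l' *s v) - y v)"
      by simp
    then show ?thesis
      using inv by (simp add: vec_eq_iff right_diff_distrib mult.commute[of _ l'] flip: mult.assoc)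
  qed
  have "card F \<le> card ?L"
  proof (rule card_le_invariant_set)
    show "x u \<in> ?L" if "u \<in> ?L" for u
      by (rule module_span_invariant[OF k'(1) x.symp _ that])
        (auto simp: xv l' intro!: span gen k' subring_setD[OF k'(1)])
    show "y u \<in> ?L" if "u \<in> ?L" for u
      by (rule module_span_invariant[OF k'(1) y.symp _ that]) (auto simp: qy intro!: span gen)
  qed (use card_module_span[OF k'(2)] gen l' span in auto)
  also have "\<dots> \<le> card k' ^ 2"
    using card_module_span[OF k'(2), of "[v, y v]"] by (simp add: power2_eq_square)
  also have "\<dots> \<le> (card k ^ m) ^ 2"
    using k' by (intro power_mono) auto
  finally show ?thesis
    by (simp add: mult.commute flip: power_mult)
qed

section \<open>A generator with eigenvalues 1, 1, w, w^2\<close>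

context
  fixes w e f
  assumes refl: "refl_map w e f x" and w: "w * w + w + 1 = 0" and three: "(3::'a) \<noteq> 0"
begin

lemma refl_form: "om e f = 1" "x v = v + ((w - 1) * om v f) *s e + ((w * w - 1) * om e v) *s f"
  using refl unfolding refl_map_def by blast+

text \<open>The adjoint of y is y^2 and the form is alternating, so pairings of e and f with their
  y-orbits reduce to four values.\<close>

lemma om_orbit:
  "om (y (y f)) f = - om (y f) f" "om e (y e) = - om (y e) e" "om e (y (y e)) = om (y e) e"
  "om e (y f) = om (y (y e)) f" "om e (y (y f)) = om (y e) f"
  using y.om_adjoint(2)[of f f] om_swap[of f "y f"] om_swap[of e "y e"] y.om_adjoint(1)[of e e]
    y.om_adjoint(2)[of e f] y.om_adjoint(1)[of e f] by simp_all

text \<open>Scaling the y-orbit of f by om (y e) e makes every coefficient of x on the six generators a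
  polynomial in w and the three given invariants.\<close>

lemma card_le_refl:
  fixes k :: "'a set"
  assumes k: "subring_set k" "finite k"
    and mem: "w \<in> k" "om (y e) f \<in> k" "om (y (y e)) f \<in> k" "om (y e) e * om (y f) f \<in> k"
  shows "card F \<le> card k ^ 6"
proof -
  define b where "b = om (y e) e"
  \<comment> \<open>Under (e, f) -> (c e, f / c) the vector b f scales like e, so the coefficients
    of x become invariants. If b = 0, the last three generators vanish, but e keeps the span
    nonzero.\<close>
  define bs where "bs = [e, y e, y (y e), b *s f, b *s y f, b *s y (y f)]"
  let ?L = "module_span k bs"
  note span = module_span_add[OF k(1)] module_span_scale[OF k(1)] module_span_minus[OF k(1)]
    module_span_diff[OF k(1)]
  have gen: "e \<in> ?L" "y e \<in> ?L" "y (y e) \<in> ?L" "b *s f \<in> ?L" "b *s y f \<in> ?L" "b *s y (y f) \<in> ?L"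
    by (rule module_span_gen[OF k(1)], simp add: bs_def)+
  have bf: "(c * b) *s f \<in> ?L" if "c \<in> k" for c
    using span(2)[OF that gen(4)] by (simp add: mult.assoc)
  have mem': "b * om (y f) f \<in> k"
    using mem by (simp add: b_def)
  have "x e = e + (w - 1) *s e"
    "x (y e) = y e + ((w - 1) * om (y e) f) *s e + ((1 - w * w) * b) *s f"
    "x (y (y e)) = y (y e) + ((w - 1) * om (y (y e)) f) *s e + ((w * w - 1) * b) *s f"
    by (simp_all add: refl_form om_bilinear om_orbit b_def vec_eq_iff algebra_simps)
  then have "x e \<in> ?L" "x (y e) \<in> ?L" "x (y (y e)) \<in> ?L"
    by (auto intro!: span gen mem bf subring_setD[OF k(1)])
  moreover have "x (b *s f) \<in> ?L" "x (b *s y f) \<in> ?L" "x (b *s y (y f)) \<in> ?L"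
  proof -
    have "x (b *s u) = b *s u + ((w - 1) * (b * om u f)) *s e + ((w * w - 1) * om e u * b) *s f" for u
      by (simp add: refl_form om_bilinear vec_eq_iff algebra_simps)
    then show "x (b *s f) \<in> ?L" "x (b *s y f) \<in> ?L" "x (b *s y (y f)) \<in> ?L"
      by (auto simp: refl_form(1) om_self om_orbit
          intro!: span gen mem mem' bf subring_setD[OF k(1)])
  qed
  ultimately have x_gen: "x u \<in> ?L" if "u \<in> set bs" for u
    using that by (auto simp: bs_def)
  have y_gen: "y u \<in> ?L" if "u \<in> set bs" for u
    using that gen by (auto simp: bs_def y.lin y.cube)
  have "card F \<le> card ?L"
  proof (rule card_le_invariant_set)
    show "e \<noteq> 0"
      using refl_form(1) by (auto simp: om_zero_left)
  qed (use card_module_span[OF k(2)] gen span module_span_invariant[OF k(1) x.symp x_gen]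
      module_span_invariant[OF k(1) y.symp y_gen] in auto)
  also have "\<dots> \<le> card k ^ 6"
    using card_module_span[OF k(2), of bs] by (simp add: bs_def numeral_eq_Suc)
  finally show ?thesis .
qed

text \<open>An eigenvector v of the product satisfies (l - y) v = (w - 1) s e + (w^2 - 1) t f for suitable
  s and t. Inverting l - y by y^3 = 1 leaves a 2 x 2 linear system for s and t.\<close>

lemma eigenvalue_of_determinant:
  assumes "l * l * l \<noteq> 1"
    and det: "(l * l * l - 1 - (w - 1) * (l * l * om (y e) f + l * om (y (y e)) f + 1))
      * (l * l * l - 1 - (w * w - 1) * (l * l * om (y (y e)) f + l * om (y e) f + 1))
      + 3 * (om (y e) e * om (y f) f) * (l * l) * ((l - 1) * (l - 1)) = 0"
  shows "l ^ m = 1"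
proof -
  define A B b c D where defs: "A = om (y e) f" "B = om (y (y e)) f" "b = om (y e) e" "c = om (y f) f"
    "D = l * l * l - 1"
  \<comment> \<open>The factor 3 in the hypothesis is (w - 1) (w^2 - 1).\<close>
  have "(D - (w - 1) * (l * l * A + l * B + 1)) * (D - (w * w - 1) * (l * l * B + l * A + 1))
      - (- ((w * w - 1) * (l * l * c - l * c))) * (- ((w - 1) * (- (l * l * b) + l * b))) = 0"
    using det w unfolding defs[symmetric] by Groebner_Basis.algebra
  then obtain s t where st: "(D - (w - 1) * (l * l * A + l * B + 1)) * s
        + (- ((w * w - 1) * (l * l * c - l * c))) * t = 0"
      "(- ((w - 1) * (- (l * l * b) + l * b))) * s
        + (D - (w * w - 1) * (l * l * B + l * A + 1)) * t = 0" "s \<noteq> 0 \<or> t \<noteq> 0"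
    by (rule singular_2x2_kernel)
  define r where "r = ((w - 1) * s) *s e + ((w * w - 1) * t) *s f"
  \<comment> \<open>As (l - y) (l^2 + l y + y^2) = l^3 - 1 = D, this is v = D (l - y)^(-1)
    r.\<close>
  define v where "v = (l * l) *s r + l *s y r + y (y r)"
  have yv: "y v = (l * l) *s y r + l *s y (y r) + r"
    by (simp add: v_def y.lin y.cube)
  have lv: "l *s v - y v = D *s r"
    by (simp add: yv vec_eq_iff defs) (simp add: v_def algebra_simps)
  have "om (y v) f = (w - 1) * s * (l * l * A + l * B + 1) + (w * w - 1) * t * (l * l * c - l * c)"
    by (simp add: yv r_def y.lin om_bilinear om_orbit refl_form(1) defs algebra_simps)
  then have 1: "om (y v) f = D * s"
    using st(1) by Groebner_Basis.algebra
  have "om e (y v) = (w - 1) * s * (- (l * l * b) + l * b) + (w * w - 1) * t * (l * l * B + l * A + 1)"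
    by (simp add: yv r_def y.lin om_bilinear om_orbit refl_form(1) defs algebra_simps)
  then have 2: "om e (y v) = D * t"
    using st(2) by Groebner_Basis.algebra
  have "x (y v) = y v + D *s r"
    unfolding refl_form(2)[of "y v"] 1 2 by (simp add: r_def vec_eq_iff algebra_simps)
  also have "\<dots> = l *s v"
    by (simp flip: lv)
  finally have eig: "x (y v) = l *s v" .
  have "v \<noteq> 0"
  proof
    assume "v = 0"
    then have "r = 0"
      using lv assms(1) by (simp add: y.lin defs)
    then have "om r f = 0" "om e r = 0"
      by (simp_all add: om_bilinear)
    then have "(w - 1) * s = 0" "(w * w - 1) * t = 0"
      by (simp_all add: r_def om_bilinear refl_form(1))
    moreover have "w \<noteq> 1" "w * w \<noteq> 1"
    proof -
      show "w \<noteq> 1"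
        using w three by auto
      moreover have "w * w * w = 1"
        using w by Groebner_Basis.algebra
      ultimately show "w * w \<noteq> 1"
        by auto
    qed
    ultimately show False
      using st(3) by simp
  qed
  with eig show ?thesis
    by (rule eigenvalue_order)
qed


text \<open>A root l of l^2 - t l + 1 has l^3 = 1 or l^m = 1, so l^(3 m) = 1 in both cases, and t =
  l + 1/l is a polynomial in l.\<close>

lemma adjoin_eigenvalue_trace:
  assumes root: "\<And>l. l * l * l \<noteq> 1 \<Longrightarrow> l * l - t * l + 1 = 0 \<Longrightarrow> l ^ m = 1"
    and k: "subring_set (k :: 'a set)" "finite k"
  obtains k' where "subring_set k'" "finite k'" "k \<subseteq> k'" "t \<in> k'" "card k' \<le> card k ^ (3 * m)"
proof -
  obtain l where l: "l * l + (- t) * l + 1 = 0"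
    using quadratic_root_exists by blast
  have "l ^ (3 * m) = 1"
  proof (cases "l * l * l = 1")
    case True
    then show ?thesis
      by (simp add: power_mult power3_eq_cube)
  next
    case False
    then have "l ^ m = 1"
      using root l by simp
    then show ?thesis
      by (simp add: mult.commute[of 3] power_mult)
  qed
  moreover from this have t: "t = l + l ^ (3 * m - 1)"
  proof -
    have "l * l ^ (3 * m - 1) = 1"
      using \<open>l ^ (3 * m) = 1\<close> m_pos by (metis power_eq_if mult_is_0 not_less0 zero_neq_numeral)
    moreover have "t = l + q" if "l * q = 1" for q
      using l that by Groebner_Basis.algebra
    ultimately show ?thesis
      by blast
  qed
  ultimately obtain k' where k': "subring_set k'" "finite k'" "k \<subseteq> k'" "l \<in> k'" "card k' \<le> card k ^ (3 * m)"
    using adjoin_root_of_unity[OF k, of "3 * m"] m_pos by auto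
  moreover have "t \<in> k'"
    unfolding t by (intro subring_setD[OF k'(1)] k')
  ultimately show ?thesis
    using that by blast
qed

text \<open>Multiplication by 3 is injective on the finite set k, hence surjective.\<close>

lemma third_mem:
  fixes k :: "'a set"
  assumes "subring_set k" "finite k" "b \<in> k" "b = 3 * a"
  shows "a \<in> k"
proof -
  have "(\<lambda>a. 3 * a) ` k \<subseteq> k"
    by (auto intro: subring_setD[OF assms(1)])
  moreover have "inj_on (\<lambda>a. 3 * a) k"
    using three by (auto simp: inj_on_def)
  ultimately have "(\<lambda>a. 3 * a) ` k = k"
    using assms(2) by (simp add: endo_inj_surj)
  then obtain c where "c \<in> k" "b = 3 * c"
    using assms(3) by blast
  then show ?thesis
    using assms(4) three by simp
qed

text \<open>The exponent collects 2 for w and 3 m for each trace.\<close>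

lemma adjoin_eigenvalue_traces:
  assumes "\<And>l. l * l * l \<noteq> 1 \<Longrightarrow> l * l - t1 * l + 1 = 0 \<Longrightarrow> l ^ m = 1"
    and "\<And>l. l * l * l \<noteq> 1 \<Longrightarrow> l * l - t2 * l + 1 = 0 \<Longrightarrow> l ^ m = 1"
    and k: "subring_set (k :: 'a set)" "finite k"
  obtains k' where "subring_set k'" "finite k'" "w \<in> k'" "t1 \<in> k'" "t2 \<in> k'"
    "card k' \<le> card k ^ (2 * (3 * m) * (3 * m))"
proof -
  obtain k1 where k1: "subring_set k1" "finite k1" "w \<in> k1" "card k1 \<le> card k ^ 2"
    using adjoin_quadratic[OF k, of 1 1 w] w subring_setD(1)[OF k(1)] by auto
  obtain k2 where k2: "subring_set k2" "finite k2" "k1 \<subseteq> k2" "t1 \<in> k2" "card k2 \<le> card k1 ^ (3 * m)"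
    using adjoin_eigenvalue_trace[OF assms(1) k1(1,2)] by blast
  obtain k3 where k3: "subring_set k3" "finite k3" "k2 \<subseteq> k3" "t2 \<in> k3" "card k3 \<le> card k2 ^ (3 * m)"
    using adjoin_eigenvalue_trace[OF assms(2) k2(1,2)] by blast
  have "card k3 \<le> ((card k ^ 2) ^ (3 * m)) ^ (3 * m)"
    using k1(4) k2(5) k3(5) by (meson le_trans power_mono zero_le)
  then have "card k3 \<le> card k ^ (2 * (3 * m) * (3 * m))"
    by (simp only: power_mult)
  then show ?thesis
    using that k1 k2 k3 by blast
qed

text \<open>The relation y^2 + y + 1 = 0 leaves the invariants A and d. The sum T of the two traces
  determines A, and their product then determines d.\<close>

lemma card_le_refl_quad:
  fixes k :: "'a set"
  assumes k: "subring_set k" "finite k" and "quad_map y"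
  shows "card F \<le> card k ^ (2 * (3 * m) * (3 * m) * 6)"
proof -
  define A d where A_d: "A = om (y e) f" "d = om (y e) e * om (y f) f"
  have B: "om (y (y e)) f = - 1 - A"
    using assms(3) by (simp add: quad_map_def om_bilinear refl_form(1) A_d)
  define T where "T = w + (w - w * w) * A"
  obtain t1 where t1: "t1 * t1 + (- T) * t1 + (T * T - 3 + 3 * d) = 0"
    using quadratic_root_exists by blast
  define t2 where "t2 = T - t1"
  have t2: "t2 * t2 + (- T) * t2 + (T * T - 3 + 3 * d) = 0"
    using t1 unfolding t2_def by Groebner_Basis.algebra
  have root: "l ^ m = 1"
    if t: "t * t + (- T) * t + (T * T - 3 + 3 * d) = 0" and l: "l * l * l \<noteq> 1" "l * l - t * l + 1 = 0" for t l
  proof (rule eigenvalue_of_determinant[OF l(1)])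
    have "(l * l + 1) * (l * l + 1) - T * l * (l * l + 1) + (T * T - 3 + 3 * d) * (l * l) = 0"
      using t l(2) by Groebner_Basis.algebra
    then show "(l * l * l - 1 - (w - 1) * (l * l * om (y e) f + l * om (y (y e)) f + 1))
      * (l * l * l - 1 - (w * w - 1) * (l * l * om (y (y e)) f + l * om (y e) f + 1))
      + 3 * (om (y e) e * om (y f) f) * (l * l) * ((l - 1) * (l - 1)) = 0"
      unfolding B A_d[symmetric] determinant_factors_quad[OF w T_def] by simp
  qed
  obtain k' where k': "subring_set k'" "finite k'" "w \<in> k'" "t1 \<in> k'" "t2 \<in> k'"
    "card k' \<le> card k ^ (2 * (3 * m) * (3 * m))"
    by (rule adjoin_eigenvalue_traces[of t1 t2 k]) (use root[OF t1] root[OF t2] k in blast)+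
  note ring = subring_setD[OF k'(1)] k'(3-5)
  have A: "A \<in> k'"
  proof (rule third_mem[OF k'(1,2)])
    \<comment> \<open>Since (w - w^2)^2 = -3, the product (T - w) (w - w^2) equals -3 A.\<close>
    show "- ((t1 + t2 - w) * (w - w * w)) \<in> k'"
      by (intro ring)
    show "- ((t1 + t2 - w) * (w - w * w)) = 3 * A"
      using w unfolding t2_def T_def by Groebner_Basis.algebra
  qed
  have d: "d \<in> k'"
  proof (rule third_mem[OF k'(1,2)])
    show "t1 * t2 - (t1 + t2) * (t1 + t2) + 3 \<in> k'"
      by (intro ring)
    show "t1 * t2 - (t1 + t2) * (t1 + t2) + 3 = 3 * d"
      using t1 unfolding t2_def by Groebner_Basis.algebra
  qed
  have "card F \<le> card k' ^ 6"
    by (rule card_le_refl[OF k'(1,2)]) (use A d in \<open>auto simp: B A_d[symmetric] intro!: ring\<close>)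
  also have "\<dots> \<le> (card k ^ (2 * (3 * m) * (3 * m))) ^ 6"
    using k'(6) by (intro power_mono) auto
  finally show ?thesis
    by (simp only: power_mult)
qed

text \<open>The pairings of e, f with g, h enter only through u and s, which do not change when (e,
  f) or (g, h) is rescaled to (c e, f / c) or (c g, h / c).\<close>

lemma card_le_refl_refl:
  fixes k :: "'a set"
  assumes k: "subring_set k" "finite k" and y_refl: "refl_map w g h y"
  shows "card F \<le> card k ^ (2 * (3 * m) * (3 * m) * 2 * 6)"
proof -
  have gh: "om g h = 1" and y: "y v = v + ((w - 1) * om v h) *s g + ((w * w - 1) * om g v) *s h" for v
    using y_refl unfolding refl_map_def by blast+
  define u s where u_s: "u = om e g * om f h" "s = om e h * om f g"
  define A B where A_B: "A = 1 - (w - 1) * s + (w * w - 1) * u" "B = 1 - (w * w - 1) * s + (w - 1) * u"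
  note swaps = om_swap[of g e] om_swap[of h e] om_swap[of g f] om_swap[of h f] om_swap[of h g]
  have A: "om (y e) f = A"
    by (simp add: y[of e] om_bilinear refl_form(1) swaps A_B u_s algebra_simps)
  have B: "om (y (y e)) f = B"
  proof -
    have "om (y e) h = w * om e h" "om g (y e) = - (w * w * om e g)"
      by (simp_all add: y[of e] om_bilinear gh swaps algebra_simps)
    then have "om (y (y e)) f = A - (w - 1) * (w * om e h) * om f g + (w * w - 1) * (w * w * om e g) * om f h"
      by (simp add: y[of "y e"] om_bilinear A swaps)
    then show ?thesis
      using w unfolding A_B u_s by Groebner_Basis.algebra
  qed
  have d: "om (y e) e * om (y f) f = - 3 * u * s"
  proof -
    have "om (y e) e = (w * w - w) * om e g * om e h" "om (y f) f = (w * w - w) * om f g * om f h"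
      by (simp_all add: y[of e] y[of f] om_bilinear swaps algebra_simps)
    then have "om (y e) e * om (y f) f = ((w * w - w) * (w * w - w)) * u * s"
      by (simp add: u_s mult_ac)
    moreover have "(w * w - w) * (w * w - w) = - 3"
      using w by Groebner_Basis.algebra
    ultimately show ?thesis
      by simp
  qed
  \<comment> \<open>In terms of t = l + 1/l, the quartic of \<open>determinant_factors_refl\<close>
    is l^2 (t^2 - T t + P).\<close>
  define T where "T = - 2 + 6 * u - 3 * s"
  define P where "P = 1 - 6 * u + 12 * s + 9 * (u - s) * (u - s)"
  obtain t1 where t1: "t1 * t1 + (- T) * t1 + P = 0"
    using quadratic_root_exists by blast
  define t2 where "t2 = T - t1"
  have t2: "t2 * t2 + (- T) * t2 + P = 0"
    using t1 unfolding t2_def by Groebner_Basis.algebra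
  have root: "l ^ m = 1"
    if t: "t * t + (- T) * t + P = 0" and l: "l * l * l \<noteq> 1" "l * l - t * l + 1 = 0" for t l
  proof (rule eigenvalue_of_determinant[OF l(1)])
    have "(l * l + 1 + l) * (l * l + 1 + l) - 6 * u * l * (l * l + 1 + l)
      + 3 * s * l * (l * l + 1 + 4 * l) + 9 * (u - s) * (u - s) * l * l = 0"
      using t l(2) unfolding T_def P_def by Groebner_Basis.algebra
    then show "(l * l * l - 1 - (w - 1) * (l * l * om (y e) f + l * om (y (y e)) f + 1))
      * (l * l * l - 1 - (w * w - 1) * (l * l * om (y (y e)) f + l * om (y e) f + 1))
      + 3 * (om (y e) e * om (y f) f) * (l * l) * ((l - 1) * (l - 1)) = 0"
      unfolding A B d determinant_factors_refl[OF w A_B] by simp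
  qed
  obtain k1 where k1: "subring_set k1" "finite k1" "w \<in> k1" "t1 \<in> k1" "t2 \<in> k1"
    "card k1 \<le> card k ^ (2 * (3 * m) * (3 * m))"
    by (rule adjoin_eigenvalue_traces[of t1 t2 k]) (use root[OF t1] root[OF t2] k in blast)+
  \<comment> \<open>Eliminating u and s from T and P gives r^2 = (t1 - 2) (t2 - 2).\<close>
  define r where "r = 3 * (u - s) - 3"
  have "r * r + 0 * r + - ((t1 - 2) * (t2 - 2)) = 0"
    using t1 unfolding r_def t2_def T_def P_def by Groebner_Basis.algebra
  moreover have "- ((t1 - 2) * (t2 - 2)) \<in> k1"
    by (intro subring_setD[OF k1(1)] k1)
  ultimately obtain k' where k': "subring_set k'" "finite k'" "k1 \<subseteq> k'" "r \<in> k'" "card k' \<le> card k1 ^ 2"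
    using adjoin_quadratic[OF k1(1,2) subring_setD(2)[OF k1(1)]] by metis
  have "w \<in> k'" "t1 \<in> k'" "t2 \<in> k'"
    using k'(3) k1 by auto
  note ring = this k'(4) subring_setD[OF k'(1)]
  \<comment> \<open>Here t1 + t2 + 2 = 6 u - 3 s and r + 3 = 3 u - 3 s; this linear system yields 3
    u and 3 s.\<close>
  have u: "u \<in> k'"
  proof (rule third_mem[OF k'(1,2)])
    show "t1 + t2 + 2 - (r + 3) \<in> k'"
      by (intro ring)
    show "t1 + t2 + 2 - (r + 3) = 3 * u"
      unfolding t2_def T_def r_def by Groebner_Basis.algebra
  qed
  have s: "s \<in> k'"
  proof (rule third_mem[OF k'(1,2)])
    show "t1 + t2 + 2 - 2 * (r + 3) \<in> k'"
      by (intro ring)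
    show "t1 + t2 + 2 - 2 * (r + 3) = 3 * s"
      unfolding t2_def T_def r_def by Groebner_Basis.algebra
  qed
  have "card F \<le> card k' ^ 6"
    by (rule card_le_refl[OF k'(1,2)]) (auto simp: A B d A_B intro!: u s ring)
  also have "\<dots> \<le> ((card k ^ (2 * (3 * m) * (3 * m))) ^ 2) ^ 6"
    using k1(6) k'(5) by (meson le_trans power_mono zero_le)
  finally show ?thesis
    by (simp only: power_mult)
qed

end

lemma card_le_refl_any:
  fixes k :: "'a set"
  assumes "subring_set k" "finite k" "refl_map w e f x" "w * w + w + 1 = 0" "(3::'a) \<noteq> 0"
  shows "card F \<le> card k ^ (216 * m * m)"
proof (cases "quad_map y")
  case True
  have "card k > 0"
    using subring_setD(1)[OF assms(1)] assms(2) card_gt_0_iff by blast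
  then have "card k ^ (2 * (3 * m) * (3 * m) * 6) \<le> card k ^ (216 * m * m)"
    by (intro power_increasing) auto
  then show ?thesis
    using card_le_refl_quad[OF assms(3,4,5,1,2) True] by simp
next
  case False
  have "y \<noteq> id"
    using sp4_generators.not_id[OF swap] .
  then obtain g h where "refl_map w g h y"
    using y.classification[OF assms(5,4) False] by blast
  then show ?thesis
    using card_le_refl_refl[OF assms(3,4,5,1,2)] by (simp add: mult_ac)
qed

theorem card_le:
  fixes k :: "'a set"
  assumes "subring_set k" "finite k"
  shows "card F \<le> card k ^ (216 * m * m)"
proof -
  obtain w :: 'a where w: "w * w + 1 * w + 1 = 0"
    using quadratic_root_exists by blast
  \<comment> \<open>A generator that is not a \<open>quad_map\<close> excludes characteristic 3, by
    \<open>quad_map_char3\<close>.\<close>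
  consider "quad_map x \<and> quad_map y" | "(3::'a) \<noteq> 0" "\<not> quad_map x" | "(3::'a) \<noteq> 0" "\<not> quad_map y"
    using x.quad_map_char3 y.quad_map_char3 by blast
  then show ?thesis
  proof cases
    case 1
    have "card k > 0"
      using subring_setD(1)[OF assms(1)] assms(2) card_gt_0_iff by blast
    then have "card k ^ (2 * m) \<le> card k ^ (216 * m * m)"
      using m_pos by (intro power_increasing) auto
    then show ?thesis
      using card_le_quad_quad 1 assms by fastforce
  next
    case 2
    then obtain e f where "refl_map w e f x"
      using x.classification not_id w by (metis mult_1)
    then show ?thesis
      using card_le_refl_any assms 2 w by simp
  next
    case 3
    interpret swapped: sp4_generators y x F m
      by (rule swap)
    obtain e f where "refl_map w e f y"
      using y.classification swapped.not_id w 3 by (metis mult_1)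
    then show ?thesis
      using swapped.card_le_refl_any assms 3 w by simp
  qed
qed

end

section \<open>Passage to an algebraically closed field\<close>

definition sympJ_matrix :: "'a::field ^ 4 ^ 4" where
  "sympJ_matrix = (\<chi> i j. om (axis i 1) (axis j 1))"

lemma symplectic_entry:
  fixes M :: "'a::field ^ 4 ^ 4"
  shows "(transpose M ** sympJ_matrix ** M) $ i $ j = om (M *v axis i 1) (M *v axis j 1)"
proof -
  have "(M *v axis i 1) $ k = M $ k $ i" for i k
    using exhaust_4[of i] by (auto simp: matrix_vector_mult_def sum_4 axis_def)
  then show ?thesis
    unfolding om_def
    by (simp add: matrix_matrix_mult_def transpose_def sympJ_matrix_def om_def sum_4)
      (simp add: axis_def algebra_simps)
qed

lemma vec4_expansion: "(v :: 'a::field ^ 4) = v$1 *s axis 1 1 + v$2 *s axis 2 1 + v$3 *s axis 3 1 + v$4 *s axis 4 1"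
  by (simp add: vec_eq_iff forall_4 axis_def)

lemma symplectic_matrix_iff:
  fixes M :: "'a::field ^ 4 ^ 4"
  shows "transpose M ** sympJ_matrix ** M = sympJ_matrix \<longleftrightarrow> symp_map ((*v) M)"
proof
  assume "transpose M ** sympJ_matrix ** M = sympJ_matrix"
  then have *: "om (M *v axis i 1) (M *v axis j 1) = om (axis i 1) (axis j 1)" for i j
    using symplectic_entry[of M i j] by (simp add: sympJ_matrix_def)
  have "om (M *v u) (M *v v) = om u v" for u v
    by (subst (1 2) vec4_expansion[of u], subst (1 2) vec4_expansion[of v])
      (simp only: matrix_vector_right_distrib vector_scalar_commute om_bilinear *)
  then show "symp_map ((*v) M)"
    by (simp add: symp_map_def matrix_vector_right_distrib vector_scalar_commute)
next
  assume "symp_map ((*v) M)"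
  then show "transpose M ** sympJ_matrix ** M = sympJ_matrix"
    by (simp add: vec_eq_iff symplectic_entry symp_map_om) (simp add: sympJ_matrix_def)
qed

lemma transvection_symp_map: "symp_map (transvection a u)"
  unfolding symp_map_def transvection_def
  by (auto simp: om_bilinear om_swap[of u] vec_eq_iff algebra_simps)

text \<open>\<open>mat4\<close> counts from 0, while vectors here are indexed by 1, 2, 3, 4, and the
  numeral 4 of type \<open>4\<close> equals 0; hence an explicit table.\<close>

definition nat_of_index :: "4 \<Rightarrow> nat" where
  "nat_of_index i = (if i = 1 then 0 else if i = 2 then 1 else if i = 3 then 2 else 3)"

definition index_of_nat :: "nat \<Rightarrow> 4" where
  "index_of_nat n = (if n = 0 then 1 else if n = 1 then 2 else if n = 2 then 3 else 4)"

lemma nat_of_index_less: "nat_of_index i < 4"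
  by (simp add: nat_of_index_def)

lemma index_of_nat_inverse: "index_of_nat (nat_of_index i) = i"
  using exhaust_4[of i] by (auto simp: nat_of_index_def index_of_nat_def)

lemma nat_of_index_inverse: "n < 4 \<Longrightarrow> nat_of_index (index_of_nat n) = n"
  by (auto simp: nat_of_index_def index_of_nat_def)

section \<open>The symplectic group of a finite field, acting over an algebraically closed
  field\<close>

locale field_embedding = field R for R :: "('r, 'b) ring_scheme" (structure) +
  fixes h :: "'r \<Rightarrow> 'k::alg_closed_field"
  assumes fin: "finite (carrier R)"
    and h_inj: "inj_on h (carrier R)"
    and h_zero: "h \<zero> = 0" and h_one: "h \<one> = 1"
    and h_add: "\<lbrakk>a \<in> carrier R; b \<in> carrier R\<rbrakk> \<Longrightarrow> h (a \<oplus> b) = h a + h b"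
    and h_mult: "\<lbrakk>a \<in> carrier R; b \<in> carrier R\<rbrakk> \<Longrightarrow> h (a \<otimes> b) = h a * h b"
begin

lemma h_minus: "a \<in> carrier R \<Longrightarrow> h (\<ominus> a) = - h a"
  using h_add[of a "\<ominus> a"] by (simp add: r_neg h_zero add_eq_0_iff)

lemma subring_image: "subring_set (h ` carrier R)"
  unfolding subring_set_def
  using h_one h_minus[symmetric] h_add[symmetric] h_mult[symmetric] by (auto intro!: image_eqI)

definition matrix_of :: "(nat \<Rightarrow> nat \<Rightarrow> 'r) \<Rightarrow> 'k ^ 4 ^ 4" where
  "matrix_of A = (\<chi> i j. h (A (nat_of_index i) (nat_of_index j)))"

lemma h_finsum4:
  fixes f :: "nat \<Rightarrow> 'r"
  assumes "\<And>i. i < 4 \<Longrightarrow> f i \<in> carrier R"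
  shows "h (finsum R f {..<4}) = h (f 0) + h (f 1) + h (f 2) + h (f 3)"
proof -
  have *: "{..<4::nat} = {0, 1, 2, 3}"
    by auto
  show ?thesis
    unfolding * using assms by (simp add: h_add h_mult add.assoc)
qed

lemma mat4_closed: "A \<in> mat4 R \<Longrightarrow> A i j \<in> carrier R"
  by (cases "i < 4 \<and> j < 4") (auto simp: mat4_def)

lemma matrix_of_mult:
  assumes "\<And>i j. A i j \<in> carrier R" "\<And>i j. B i j \<in> carrier R"
  shows "matrix_of (mat4_mult R A B) = matrix_of A ** matrix_of B"
proof -
  have "h (mat4_mult R A B m n) = h (A m 0) * h (B 0 n) + h (A m 1) * h (B 1 n)
      + h (A m 2) * h (B 2 n) + h (A m 3) * h (B 3 n)" if "m < 4" "n < 4" for m n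
    using that assms by (simp add: mat4_mult_def h_finsum4 h_mult)
  then show ?thesis
    by (simp add: vec_eq_iff matrix_of_def matrix_matrix_mult_def sum_4 nat_of_index_less)
      (simp add: nat_of_index_def)
qed

lemma mat4_mult_closed:
  assumes "A \<in> mat4 R" "B \<in> mat4 R"
  shows "mat4_mult R A B \<in> mat4 R"
  using assms by (auto simp: mat4_def mat4_mult_def intro!: finsum_closed m_closed)

lemma matrix_of_inj:
  assumes "A \<in> mat4 R" "B \<in> mat4 R" "matrix_of A = matrix_of B"
  shows "A = B"
proof (intro ext)
  fix i j
  show "A i j = B i j"
  proof (cases "i < 4 \<and> j < 4")
    case True
    have "h (A i j) = h (B i j)"
      using arg_cong[OF assms(3), of "\<lambda>M. M $ index_of_nat i $ index_of_nat j"] True by (simp add: matrix_of_def nat_of_index_inverse)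
    then show ?thesis
      using h_inj mat4_closed assms by (auto dest: inj_onD)
  next
    case False
    then show ?thesis
      using assms by (auto simp: mat4_def)
  qed
qed

lemma matrix_of_surj:
  fixes M :: "'k ^ 4 ^ 4"
  assumes "\<And>i j. M $ i $ j \<in> h ` carrier R"
  obtains A where "A \<in> mat4 R" "matrix_of A = M"
proof -
  define A where "A i j = (if i < 4 \<and> j < 4 then inv_into (carrier R) h (M $ index_of_nat i $ index_of_nat j) else \<zero>)" for i j
  have "A \<in> mat4 R"
    using assms by (auto simp: mat4_def A_def inv_into_into)
  moreover have "matrix_of A = M"
    using assms by (simp add: vec_eq_iff matrix_of_def A_def nat_of_index_less index_of_nat_inverse f_inv_into_f)
  ultimately show ?thesis
    using that by blast
qed

lemma mat4_one_closed: "mat4_one R \<in> mat4 R"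
  by (auto simp: mat4_def mat4_one_def)

lemma matrix_of_one: "matrix_of (mat4_one R) = mat 1"
proof -
  have "nat_of_index i = nat_of_index j \<longleftrightarrow> i = j" for i j
    by (metis index_of_nat_inverse)
  then show ?thesis
    by (simp add: vec_eq_iff matrix_of_def mat4_one_def mat_def nat_of_index_less h_one h_zero)
qed

lemma matrix_of_sympJ: "matrix_of (sympJ R) = sympJ_matrix"
  by (simp add: vec_eq_iff forall_4 matrix_of_def sympJ_def sympJ_matrix_def om_def axis_def nat_of_index_def
      h_one h_zero h_minus)

lemma sympJ_closed: "sympJ R \<in> mat4 R"
  by (auto simp: mat4_def sympJ_def)

lemma Sp4_iff: "A \<in> carrier (Sp4 R) \<longleftrightarrow> A \<in> mat4 R \<and> symp_map ((*v) (matrix_of A))"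
proof -
  have "mat4_mult R (mat4_mult R (mat4_transpose A) (sympJ R)) A = sympJ R
      \<longleftrightarrow> transpose (matrix_of A) ** sympJ_matrix ** matrix_of A = sympJ_matrix" if A: "A \<in> mat4 R"
  proof -
    have T: "mat4_transpose A \<in> mat4 R"
      using A by (auto simp: mat4_def mat4_transpose_def)
    have "matrix_of (mat4_transpose A) = transpose (matrix_of A)"
      by (simp add: vec_eq_iff matrix_of_def mat4_transpose_def transpose_def)
    then have "matrix_of (mat4_mult R (mat4_mult R (mat4_transpose A) (sympJ R)) A)
      = transpose (matrix_of A) ** sympJ_matrix ** matrix_of A"
      using A T sympJ_closed by (simp add: matrix_of_mult mat4_mult_closed mat4_closed matrix_of_sympJ)
    then show ?thesis
      using matrix_of_inj matrix_of_sympJ A T sympJ_closed mat4_mult_closed by metis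
  qed
  then show ?thesis
    by (auto simp: Sp4_def symplectic_matrix_iff)
qed

definition act :: "(nat \<Rightarrow> nat \<Rightarrow> 'r) \<Rightarrow> 'k ^ 4 \<Rightarrow> 'k ^ 4" where
  "act A = (*v) (matrix_of A)"

lemma act_mult:
  assumes "A \<in> carrier (Sp4 R)" "B \<in> carrier (Sp4 R)"
  shows "act (A \<otimes>\<^bsub>Sp4 R\<^esub> B) = act A \<circ> act B"
  using assms by (auto simp: act_def fun_eq_iff Sp4_iff matrix_of_mult mat4_closed matrix_vector_mul_assoc Sp4_def)

lemma act_one: "act \<one>\<^bsub>Sp4 R\<^esub> = id"
  by (auto simp: act_def fun_eq_iff Sp4_def matrix_of_one)

lemma act_symp: "A \<in> carrier (Sp4 R) \<Longrightarrow> symp_map (act A)"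
  by (simp add: Sp4_iff act_def)

lemma act_inj: "A \<in> carrier (Sp4 R) \<Longrightarrow> B \<in> carrier (Sp4 R) \<Longrightarrow> act A = act B \<Longrightarrow> A = B"
  using matrix_of_inj matrix_eq[of "matrix_of A" "matrix_of B"] by (auto simp: act_def Sp4_iff fun_eq_iff)

lemma act_surj:
  fixes g :: "'k ^ 4 \<Rightarrow> 'k ^ 4"
  assumes "symp_map g" "\<And>i j. g (axis j 1) $ i \<in> h ` carrier R"
  obtains A where "A \<in> carrier (Sp4 R)" "act A = g"
proof -
  define M where "M = (\<chi> i j. g (axis j 1) $ i)"
  have g: "(*v) M = g"
  proof
    fix v
    have "g v = v$1 *s g (axis 1 1) + v$2 *s g (axis 2 1) + v$3 *s g (axis 3 1) + v$4 *s g (axis 4 1)"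
      by (subst vec4_expansion[of v]) (simp only: symp_map_linear[OF assms(1)])
    then show "M *v v = g v"
      by (simp add: vec_eq_iff M_def matrix_vector_mult_def sum_4 algebra_simps)
  qed
  obtain A where A: "A \<in> mat4 R" "matrix_of A = M"
    using matrix_of_surj[of M] assms(2) by (auto simp: M_def)
  then show ?thesis
    using that[of A] assms(1) g by (simp add: Sp4_iff act_def)
qed

lemma Sp4_group: "group (Sp4 R)"
proof (rule groupI)
  let ?G = "Sp4 R"
  show closed: "A \<otimes>\<^bsub>?G\<^esub> B \<in> carrier ?G" if "A \<in> carrier ?G" "B \<in> carrier ?G" for A B
  proof -
    have "symp_map (act A \<circ> act B)"
      using that by (intro symp_map_comp act_symp)
    moreover have "A \<otimes>\<^bsub>?G\<^esub> B \<in> mat4 R"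
      using that by (simp add: Sp4_def mat4_mult_closed)
    ultimately show ?thesis
      using act_mult[OF that] by (simp add: Sp4_iff act_def)
  qed
  show one: "\<one>\<^bsub>?G\<^esub> \<in> carrier ?G"
  proof -
    have "\<one>\<^bsub>?G\<^esub> \<in> mat4 R"
      by (simp add: Sp4_def mat4_one_closed)
    then show ?thesis
      using act_one by (simp add: Sp4_iff act_def symp_map_def)
  qed
  show "A \<otimes>\<^bsub>?G\<^esub> B \<otimes>\<^bsub>?G\<^esub> C = A \<otimes>\<^bsub>?G\<^esub> (B \<otimes>\<^bsub>?G\<^esub> C)"
    if "A \<in> carrier ?G" "B \<in> carrier ?G" "C \<in> carrier ?G" for A B C
    by (rule act_inj) (use that closed in \<open>auto simp: act_mult comp_assoc\<close>)
  show "\<one>\<^bsub>?G\<^esub> \<otimes>\<^bsub>?G\<^esub> A = A" if "A \<in> carrier ?G" for A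
    by (rule act_inj) (use that closed one in \<open>auto simp: act_mult act_one\<close>)
  show "\<exists>B\<in>carrier ?G. B \<otimes>\<^bsub>?G\<^esub> A = \<one>\<^bsub>?G\<^esub>" if A: "A \<in> carrier ?G" for A
  proof -
    define M where "M = matrix_of A"
    \<comment> \<open>With J^2 = -1, the relation M^T J M = J says that - J M^T J inverts M. Its
      entries are ring expressions in those of M and J, so it comes from
      \<open>mat4 R\<close>.\<close>
    define N where "N = - (sympJ_matrix ** transpose M ** sympJ_matrix)"
    have J2: "sympJ_matrix ** sympJ_matrix = - (mat 1 :: 'k ^ 4 ^ 4)"
      by (simp add: vec_eq_iff forall_4 matrix_matrix_mult_def sum_4 sympJ_matrix_def om_def axis_def mat_def)
    have M: "transpose M ** sympJ_matrix ** M = sympJ_matrix"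
      using A by (simp add: Sp4_iff M_def symplectic_matrix_iff)
    have neg: "(- P) ** Q = - (P ** Q)" for P Q :: "'k ^ 4 ^ 4"
      by (simp add: matrix_matrix_mult_def vec_eq_iff sum_negf)
    have "N ** M = - (sympJ_matrix ** (transpose M ** sympJ_matrix ** M))"
      by (simp add: N_def neg matrix_mul_assoc)
    then have NM: "N ** M = mat 1"
      by (simp add: M J2)
    then have MN: "M ** N = mat 1"
      by (simp add: matrix_left_right_inverse)
    have "M $ i $ j \<in> h ` carrier R" for i j
      using A by (auto simp: M_def matrix_of_def Sp4_iff mat4_closed)
    moreover have "sympJ_matrix $ i $ j \<in> h ` carrier R" for i j
      using sympJ_closed by (auto simp: matrix_of_def mat4_closed simp flip: matrix_of_sympJ)
    ultimately have "N $ i $ j \<in> h ` carrier R" for i j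
      by (simp add: N_def matrix_matrix_mult_def sum_4 transpose_def subring_setD[OF subring_image])
    then obtain B where B: "B \<in> mat4 R" "matrix_of B = N"
      using matrix_of_surj by blast
    have "om (N *v u) (N *v v) = om u v" for u v
    proof -
      have "om (M *v (N *v u)) (M *v (N *v v)) = om (N *v u) (N *v v)"
        using A by (simp add: Sp4_iff M_def symp_map_om)
      then show ?thesis
        by (simp add: matrix_vector_mul_assoc MN)
    qed
    then have "B \<in> carrier ?G"
      using B by (simp add: Sp4_iff symp_map_def matrix_vector_right_distrib vector_scalar_commute)
    moreover from this have "act (B \<otimes>\<^bsub>?G\<^esub> A) = id"
      using A B(2) NM by (simp add: act_mult) (simp add: act_def fun_eq_iff matrix_vector_mul_assoc M_def)
    ultimately show ?thesis
      using act_inj closed one act_one A by metis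
  qed
qed

lemma Sp4_finite: "finite (carrier (Sp4 R))"
proof -
  let ?I = "{..<4::nat} \<times> {..<4::nat}"
  have "mat4 R \<subseteq> curry ` {f. \<forall>p. (p \<in> ?I \<longrightarrow> f p \<in> carrier R) \<and> (p \<notin> ?I \<longrightarrow> f p = \<zero>)}"
  proof
    fix A assume "A \<in> mat4 R"
    then show "A \<in> curry ` {f. \<forall>p. (p \<in> ?I \<longrightarrow> f p \<in> carrier R) \<and> (p \<notin> ?I \<longrightarrow> f p = \<zero>)}"
      by (intro image_eqI[of _ _ "case_prod A"]) (auto simp: mat4_def)
  qed
  moreover have "finite {f. \<forall>p. (p \<in> ?I \<longrightarrow> f p \<in> carrier R) \<and> (p \<notin> ?I \<longrightarrow> f p = \<zero>)}"
    by (rule finite_set_of_finite_funs) (auto simp: fin)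
  ultimately have "finite (mat4 R)"
    using finite_surj by blast
  then show ?thesis
    by (rule rev_finite_subset) (auto simp: Sp4_def)
qed

lemma transvection_in_image:
  fixes u :: "'k ^ 4"
  assumes "a \<in> h ` carrier R" "\<And>i. u $ i \<in> {0, 1}"
  obtains A where "A \<in> carrier (Sp4 R)" "act A = transvection a u"
proof (rule act_surj)
  note ring = subring_setD[OF subring_image]
  have u: "u $ i \<in> h ` carrier R" for i
    using assms(2)[of i] ring(1,2) by auto
  show "transvection a u (axis j 1) $ i \<in> h ` carrier R" for i j
    by (simp add: transvection_def om_def axis_def u ring assms(1))
qed (use transvection_symp_map that in auto)

text \<open>A central element commutes with the transvections over the small field, hence is scalar;
  preservation of the form gives s^2 = 1.\<close>

lemma act_center:
  assumes "z \<in> group_center (Sp4 R)"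
  obtains s where "s * s = 1" "\<And>v. act z v = s *s v"
proof -
  have z: "z \<in> carrier (Sp4 R)" and comm: "\<And>g. g \<in> carrier (Sp4 R) \<Longrightarrow> z \<otimes>\<^bsub>Sp4 R\<^esub> g = g \<otimes>\<^bsub>Sp4 R\<^esub> z"
    using assms by (auto simp: group_center_def)
  note lin = symp_map_linear[OF act_symp[OF z]]
  obtain s where s: "\<And>v. act z v = s *s v"
  proof (rule transvection_commuting_is_scalar[OF lin(1,2)])
    show "act z (transvection 1 u v) = transvection 1 u (act z v)" if u: "\<And>i. u $ i \<in> {0, 1}" for u v :: "'k ^ 4"
    proof -
      obtain A where A: "A \<in> carrier (Sp4 R)" "act A = transvection 1 u"
        by (rule transvection_in_image[of 1 u]) (use u subring_setD(1)[OF subring_image] in auto)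
      have "act z \<circ> act A = act A \<circ> act z"
        using comm[OF A(1)] A(1) z by (metis act_mult)
      then show ?thesis
        by (simp add: A(2) fun_eq_iff)
    qed
  qed (rule that)
  have "om (act z (axis 1 1)) (act z (axis 3 1)) = om (axis 1 1) (axis 3 1)"
    by (rule symp_map_om[OF act_symp[OF z]])
  then have "s * s = 1"
    by (simp add: s om_bilinear) (simp add: om_def axis_def)
  then show ?thesis
    using that s by blast
qed

text \<open>The relations modulo the centre and the generation by x, y and the centre hold for Sp4
  and for lifts from PSp4 alike, so both cases follow from here.\<close>

lemma card_le_of_generators:
  fixes k :: "'k set"
  assumes xy: "x \<in> carrier (Sp4 R)" "y \<in> carrier (Sp4 R)" and "c > 0"
    and central: "x [^]\<^bsub>Sp4 R\<^esub> (3::nat) \<in> group_center (Sp4 R)" "y [^]\<^bsub>Sp4 R\<^esub> (3::nat) \<in> group_center (Sp4 R)"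
      "(x \<otimes>\<^bsub>Sp4 R\<^esub> y) [^]\<^bsub>Sp4 R\<^esub> c \<in> group_center (Sp4 R)"
    and gen: "\<And>H. subgroup H (Sp4 R) \<Longrightarrow> group_center (Sp4 R) \<subseteq> H \<Longrightarrow> x \<in> H \<Longrightarrow> y \<in> H \<Longrightarrow> H = carrier (Sp4 R)"
    and k: "subring_set k" "finite k"
  shows "card (carrier R) \<le> card k ^ (216 * (2 * c) * (2 * c))"
proof -
  interpret G: group "Sp4 R"
    by (rule Sp4_group)
  have act_pow: "act (g [^]\<^bsub>Sp4 R\<^esub> n) = act g ^^ n" if "g \<in> carrier (Sp4 R)" for g and n :: nat
    using that by (induction n) (simp_all add: act_one act_mult funpow_swap1 fun_eq_iff)
  have act_cube: "act (g [^]\<^bsub>Sp4 R\<^esub> (3::nat)) v = act g (act g (act g v))" if "g \<in> carrier (Sp4 R)" for g v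
    unfolding act_pow[OF that] by (simp add: numeral_3_eq_3)
  obtain a where a: "a * a = 1" "\<And>v. act x (act x (act x v)) = a *s v"
    using act_center[OF central(1)] act_cube[OF xy(1)] by metis
  obtain b where b: "b * b = 1" "\<And>v. act y (act y (act y v)) = b *s v"
    using act_center[OF central(2)] act_cube[OF xy(2)] by metis
  obtain d where d: "d * d = 1" "\<And>v. ((act x \<circ> act y) ^^ c) v = d *s v"
    using act_center[OF central(3)] xy by (metis act_pow act_mult G.m_closed)
  note lx = symp_map_linear[OF act_symp[OF xy(1)]] and ly = symp_map_linear[OF act_symp[OF xy(2)]]
  \<comment> \<open>As x^3 = a with a^2 = 1, (a x)^3 = a^4 = 1. The c-th power of the new product is
    a scalar of square 1, hence the exponent 2 c.\<close>
  define x1 where "x1 v = a *s act x v" for v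
  define y1 where "y1 v = b *s act y v" for v
  have symp: "symp_map x1" "symp_map y1"
    using a(1) b(1) symp_map_om[OF act_symp[OF xy(1)]] symp_map_om[OF act_symp[OF xy(2)]]
    by (auto simp: symp_map_def x1_def y1_def lx ly om_bilinear vec_eq_iff algebra_simps mult.assoc[symmetric])
  have "sp4_generators x1 y1 (h ` carrier R) (2 * c)"
  proof unfold_locales
    show "x1 (x1 (x1 v)) = v" for v
      using a by (simp add: x1_def lx)
    show "y1 (y1 (y1 v)) = v" for v
      using b by (simp add: y1_def ly)
    show "((x1 \<circ> y1) ^^ (2 * c)) v = v" for v
    proof -
      have "((x1 \<circ> y1) ^^ n) v = (a * b) ^ n *s ((act x \<circ> act y) ^^ n) v" for n v
        by (induction n) (simp_all add: x1_def y1_def lx ly mult_ac)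
      then have "((x1 \<circ> y1) ^^ c) v = ((a * b) ^ c * d) *s v" for v
        by (simp add: d)
      then have "((x1 \<circ> y1) ^^ (c + c)) v = (((a * b) ^ c * d) * ((a * b) ^ c * d)) *s v"
        by (simp add: funpow_add symp_map_linear[OF symp(1)])
      also have "((a * b) ^ c * d) * ((a * b) ^ c * d) = ((a * a) * (b * b)) ^ c * (d * d)"
        by (simp add: power_mult_distrib mult_ac)
      finally show ?thesis
        using a(1) b(1) d(1) by (simp only: mult_2 mult_1 power_one vector_smult_lid)
    qed
    show "transvection r u \<in> S"
      if S: "x1 \<in> S" "y1 \<in> S" "uminus \<in> S" "\<And>f g. f \<in> S \<Longrightarrow> g \<in> S \<Longrightarrow> f \<circ> g \<in> S"
        and r: "r \<in> h ` carrier R" and u: "\<And>i. u $ i \<in> {0, 1}" for S r and u :: "'k ^ 4"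
    proof -
      have id: "id \<in> S"
        using S(4)[OF S(3,3)] by (simp add: comp_def id_def)
      have scalar: "f \<in> S" if "s * s = 1" "\<And>v. f v = s *s g v" "g \<in> S" for f g s
      proof -
        have "s = 1 \<or> s = -1"
          using that(1) by (simp add: square_eq_1_iff)
        then have "f = g \<or> f = uminus \<circ> g"
          using that(2) by (auto simp: fun_eq_iff)
        then show ?thesis
          using that(3) S(3,4) by auto
      qed
      define H where "H = {g \<in> carrier (Sp4 R). act g \<in> S}"
      have one: "\<one>\<^bsub>Sp4 R\<^esub> \<in> H"
        using id by (simp add: H_def act_one)
      have mult: "g \<otimes>\<^bsub>Sp4 R\<^esub> g' \<in> H" if "g \<in> H" "g' \<in> H" for g g'
        using that S(4) by (auto simp: H_def act_mult)
      have "subgroup H (Sp4 R)"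
      proof (rule G.subgroupI)
        \<comment> \<open>S is closed only under composition, so the inverse is obtained as the
          power of g with exponent one less than the group order.\<close>
        show "inv\<^bsub>Sp4 R\<^esub> g \<in> H" if "g \<in> H" for g
        proof -
          have g: "g \<in> carrier (Sp4 R)"
            using that by (simp add: H_def)
          have "g [^]\<^bsub>Sp4 R\<^esub> n \<in> H" for n :: nat
            using that by (induction n) (auto intro: one mult)
          moreover have "g [^]\<^bsub>Sp4 R\<^esub> (Coset.order (Sp4 R) - 1) \<otimes>\<^bsub>Sp4 R\<^esub> g = \<one>\<^bsub>Sp4 R\<^esub>"
          proof -
            have "Coset.order (Sp4 R) > 0"
              using Sp4_finite G.order_gt_0_iff_finite by blast
            then show ?thesis
              using G.pow_order_eq_1[OF g] G.nat_pow_Suc[of g "Coset.order (Sp4 R) - 1"] by simp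
          qed
          ultimately show ?thesis
            using G.inv_equality g by (metis G.nat_pow_closed)
        qed
      qed (use one mult in \<open>auto simp: H_def\<close>)
      moreover have "group_center (Sp4 R) \<subseteq> H"
      proof
        fix z assume z: "z \<in> group_center (Sp4 R)"
        obtain s where s: "s * s = 1" "\<And>v. act z v = s *s v"
          using act_center[OF z] by blast
        have "act z \<in> S"
          by (rule scalar[OF s(1) _ id]) (simp add: s)
        then show "z \<in> H"
          using z by (simp add: H_def group_center_def)
      qed
      moreover have "act x \<in> S"
        by (rule scalar[OF a(1) _ S(1)]) (simp add: x1_def a(1))
      then have "x \<in> H"
        using xy by (simp add: H_def)
      moreover have "act y \<in> S"
        by (rule scalar[OF b(1) _ S(2)]) (simp add: y1_def b(1))
      then have "y \<in> H"
        using xy by (simp add: H_def)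
      ultimately have "H = carrier (Sp4 R)"
        by (rule gen)
      moreover obtain A where "A \<in> carrier (Sp4 R)" "act A = transvection r u"
        by (rule transvection_in_image[OF r]) (use u in auto)
      ultimately show ?thesis
        unfolding H_def by (metis (mono_tags, lifting) mem_Collect_eq)
    qed
    show "1 \<in> h ` carrier R"
      by (rule subring_setD(1)[OF subring_image])
  qed (use symp \<open>c > 0\<close> in auto)
  then have "card (h ` carrier R) \<le> card k ^ (216 * (2 * c) * (2 * c))"
    using sp4_generators.card_le k by blast
  then show ?thesis
    by (simp add: card_image h_inj)
qed

lemma center_normal: "group_center (Sp4 R) \<lhd> Sp4 R"
proof -
  interpret G: group "Sp4 R"
    by (rule Sp4_group)
  have comm: "z \<in> carrier (Sp4 R)" "g \<in> carrier (Sp4 R) \<Longrightarrow> z \<otimes>\<^bsub>Sp4 R\<^esub> g = g \<otimes>\<^bsub>Sp4 R\<^esub> z"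
    if "z \<in> group_center (Sp4 R)" for z g
    using that by (auto simp: group_center_def)
  have "subgroup (group_center (Sp4 R)) (Sp4 R)"
  proof (rule G.subgroupI)
    fix z assume z: "z \<in> group_center (Sp4 R)"
    have "inv\<^bsub>Sp4 R\<^esub> z \<otimes>\<^bsub>Sp4 R\<^esub> g = g \<otimes>\<^bsub>Sp4 R\<^esub> inv\<^bsub>Sp4 R\<^esub> z" if g: "g \<in> carrier (Sp4 R)" for g
    proof -
      have "z \<otimes>\<^bsub>Sp4 R\<^esub> (g \<otimes>\<^bsub>Sp4 R\<^esub> inv\<^bsub>Sp4 R\<^esub> z) = g"
        using comm(1)[OF z] comm(2)[OF z g] g by (simp add: G.m_assoc flip: G.m_assoc[of z])
      then show ?thesis
        using comm(1)[OF z] g G.inv_solve_left[of "g \<otimes>\<^bsub>Sp4 R\<^esub> inv\<^bsub>Sp4 R\<^esub> z" z g] by simp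
    qed
    then show "inv\<^bsub>Sp4 R\<^esub> z \<in> group_center (Sp4 R)"
      using comm(1)[OF z] by (simp add: group_center_def)
  next
    fix z z' assume z: "z \<in> group_center (Sp4 R)" "z' \<in> group_center (Sp4 R)"
    have "z \<otimes>\<^bsub>Sp4 R\<^esub> z' \<otimes>\<^bsub>Sp4 R\<^esub> g = g \<otimes>\<^bsub>Sp4 R\<^esub> (z \<otimes>\<^bsub>Sp4 R\<^esub> z')" if g: "g \<in> carrier (Sp4 R)" for g
    proof -
      have "z \<otimes>\<^bsub>Sp4 R\<^esub> z' \<otimes>\<^bsub>Sp4 R\<^esub> g = z \<otimes>\<^bsub>Sp4 R\<^esub> g \<otimes>\<^bsub>Sp4 R\<^esub> z'"
        using z g comm(1) comm(2)[OF z(2) g] by (simp add: G.m_assoc)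
      also have "\<dots> = g \<otimes>\<^bsub>Sp4 R\<^esub> z \<otimes>\<^bsub>Sp4 R\<^esub> z'"
        using comm(2)[OF z(1) g] by simp
      also have "\<dots> = g \<otimes>\<^bsub>Sp4 R\<^esub> (z \<otimes>\<^bsub>Sp4 R\<^esub> z')"
        using z g comm(1) by (simp add: G.m_assoc)
      finally show ?thesis .
    qed
    then show "z \<otimes>\<^bsub>Sp4 R\<^esub> z' \<in> group_center (Sp4 R)"
      using G.m_closed[OF comm(1)[OF z(1)] comm(1)[OF z(2)]] unfolding group_center_def by blast
  qed (auto simp: group_center_def)
  then show ?thesis
  proof (rule G.normal_invI)
    fix g z assume g: "g \<in> carrier (Sp4 R)" and z: "z \<in> group_center (Sp4 R)"
    have "g \<otimes>\<^bsub>Sp4 R\<^esub> z \<otimes>\<^bsub>Sp4 R\<^esub> inv\<^bsub>Sp4 R\<^esub> g = z"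
      using comm(1)[OF z] g unfolding comm(2)[OF z g, symmetric] by (simp add: G.m_assoc)
    then show "g \<otimes>\<^bsub>Sp4 R\<^esub> z \<otimes>\<^bsub>Sp4 R\<^esub> inv\<^bsub>Sp4 R\<^esub> g \<in> group_center (Sp4 R)"
      using z by simp
  qed
qed

lemma card_le_Sp4:
  fixes k :: "'k set"
  assumes "is_33c_group (Sp4 R) c" "c > 0" and k: "subring_set k" "finite k"
  shows "card (carrier R) \<le> card k ^ (216 * (2 * c) * (2 * c))"
proof -
  interpret G: group "Sp4 R"
    by (rule Sp4_group)
  obtain x y where xy: "x \<in> carrier (Sp4 R)" "y \<in> carrier (Sp4 R)" "generate (Sp4 R) {x, y} = carrier (Sp4 R)"
    "x [^]\<^bsub>Sp4 R\<^esub> (3::nat) = \<one>\<^bsub>Sp4 R\<^esub>" "y [^]\<^bsub>Sp4 R\<^esub> (3::nat) = \<one>\<^bsub>Sp4 R\<^esub>"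
    "(x \<otimes>\<^bsub>Sp4 R\<^esub> y) [^]\<^bsub>Sp4 R\<^esub> c = \<one>\<^bsub>Sp4 R\<^esub>"
    using assms(1) by (auto simp: is_33c_group_def)
  have one: "\<one>\<^bsub>Sp4 R\<^esub> \<in> group_center (Sp4 R)"
    by (simp add: group_center_def)
  show ?thesis
  proof (rule card_le_of_generators[OF xy(1,2) assms(2) _ _ _ _ k])
    show "H = carrier (Sp4 R)" if "subgroup H (Sp4 R)" "x \<in> H" "y \<in> H" for H
      using G.generate_subgroup_incl[of "{x, y}" H] that xy(3) subgroup.subset by blast
  qed (use xy one in auto)
qed

text \<open>Lifts of the generators satisfy the relations modulo the centre. A subgroup that
  contains the centre is the full preimage of its image, so it is everything once its image
  is.\<close>

lemma card_le_PSp4: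
  fixes k :: "'k set"
  assumes "is_33c_group (PSp4 R) c" "c > 0" and k: "subring_set k" "finite k"
  shows "card (carrier R) \<le> card k ^ (216 * (2 * c) * (2 * c))"
proof -
  define N where "N = group_center (Sp4 R)"
  interpret N: normal N "Sp4 R"
    unfolding N_def by (rule center_normal)
  define \<pi> where "\<pi> g = N #>\<^bsub>Sp4 R\<^esub> g" for g
  interpret \<pi>: group_hom "Sp4 R" "Sp4 R Mod N" \<pi>
    using N.r_coset_hom_Mod N.factorgroup_is_group
    by (auto simp: group_hom_def group_hom_axioms_def \<pi>_def[abs_def] N.is_group)
  obtain x' y' where xy': "x' \<in> carrier (Sp4 R Mod N)" "y' \<in> carrier (Sp4 R Mod N)"
    "generate (Sp4 R Mod N) {x', y'} = carrier (Sp4 R Mod N)"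
    "x' [^]\<^bsub>Sp4 R Mod N\<^esub> (3::nat) = \<one>\<^bsub>Sp4 R Mod N\<^esub>" "y' [^]\<^bsub>Sp4 R Mod N\<^esub> (3::nat) = \<one>\<^bsub>Sp4 R Mod N\<^esub>"
    "(x' \<otimes>\<^bsub>Sp4 R Mod N\<^esub> y') [^]\<^bsub>Sp4 R Mod N\<^esub> c = \<one>\<^bsub>Sp4 R Mod N\<^esub>"
    using assms(1) by (auto simp: is_33c_group_def PSp4_def N_def)
  obtain x y where xy: "x \<in> carrier (Sp4 R)" "y \<in> carrier (Sp4 R)" "x' = \<pi> x" "y' = \<pi> y"
    using xy'(1,2) by (auto simp: carrier_FactGroup \<pi>_def)
  have ker: "g \<in> N" if "g \<in> carrier (Sp4 R)" "\<pi> g = \<one>\<^bsub>Sp4 R Mod N\<^esub>" for g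
    using that N.coset_join1[of N g] N.subgroup_axioms by (simp add: \<pi>_def)
  show ?thesis
  proof (rule card_le_of_generators[OF xy(1,2) assms(2) _ _ _ _ k])
    show "x [^]\<^bsub>Sp4 R\<^esub> (3::nat) \<in> group_center (Sp4 R)" "y [^]\<^bsub>Sp4 R\<^esub> (3::nat) \<in> group_center (Sp4 R)"
      "(x \<otimes>\<^bsub>Sp4 R\<^esub> y) [^]\<^bsub>Sp4 R\<^esub> c \<in> group_center (Sp4 R)"
      unfolding N_def[symmetric] using xy xy' by (auto intro!: ker simp: \<pi>.hom_nat_pow)
    show "H = carrier (Sp4 R)" if H: "subgroup H (Sp4 R)" "group_center (Sp4 R) \<subseteq> H" "x \<in> H" "y \<in> H" for H
    proof
      show "H \<subseteq> carrier (Sp4 R)"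
        using H(1) by (rule subgroup.subset)
      show "carrier (Sp4 R) \<subseteq> H"
      proof
        fix g assume g: "g \<in> carrier (Sp4 R)"
        have "subgroup (\<pi> ` H) (Sp4 R Mod N)"
          using \<pi>.subgroup_img_is_subgroup H(1) by blast
        then have "generate (Sp4 R Mod N) {x', y'} \<subseteq> \<pi> ` H"
          using \<pi>.H.generate_subgroup_incl[of "{x', y'}" "\<pi> ` H"] H(3,4) xy(3,4) by blast
        then have "\<pi> g \<in> \<pi> ` H"
          using \<pi>.hom_closed[OF g] unfolding xy'(3) by blast
        then obtain g' where g': "g' \<in> H" "\<pi> g = \<pi> g'"
          by blast
        have "g \<in> N #>\<^bsub>Sp4 R\<^esub> g"
          using g N.rcos_self N.subgroup_axioms by blast
        then have "g \<in> N #>\<^bsub>Sp4 R\<^esub> g'"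
          using g'(2) by (simp add: \<pi>_def)
        then obtain n where "n \<in> N" "g = n \<otimes>\<^bsub>Sp4 R\<^esub> g'"
          by (auto simp: r_coset_def)
        then show "g \<in> H"
          using H(1,2) g'(1) by (auto simp: N_def intro: subgroup.m_closed)
      qed
    qed
  qed
qed

text \<open>The additive order p^r kills 1, so p = 0 in the closed field. Natural numbers then
  matter only modulo p, and - n = n (p - 1).\<close>

lemma prime_subring:
  assumes "card (carrier R) = p ^ r" "p > 0"
  obtains k :: "'k set" where "subring_set k" "finite k" "card k \<le> p"
proof -
  have h_nat: "h ([n] \<cdot> \<one>) = of_nat n" for n :: nat
    by (induction n) (simp_all add: h_zero h_add h_one add.commute)
  have "add_pow R (Coset.order (add_monoid R)) \<one> = \<zero>"
    using add.pow_order_eq_1[of \<one>] by (simp add: add_pow_def)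
  then have "(of_nat (p ^ r) :: 'k) = 0"
    using h_nat[of "p ^ r"] assms(1) by (simp add: Coset.order_def h_zero)
  then have p0: "(of_nat p :: 'k) = 0"
    by simp
  define k :: "'k set" where "k = range of_nat"
  have "k \<subseteq> of_nat ` {..<p}"
  proof
    fix a assume "a \<in> k"
    then obtain n where "a = of_nat n"
      by (auto simp: k_def)
    moreover have "(of_nat n :: 'k) = of_nat (n mod p)"
      by (metis add_0 mult_not_zero mult_div_mod_eq of_nat_add of_nat_mult p0)
    ultimately show "a \<in> of_nat ` {..<p}"
      using assms(2) by auto
  qed
  then have "finite k" "card k \<le> p"
    by (auto intro: finite_surj dest: surj_card_le[rotated])
  moreover have "subring_set k"
  proof -
    have "(- of_nat n :: 'k) = of_nat (n * (p - 1))" for n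
      using assms(2) p0 by (simp add: of_nat_diff)
    then show ?thesis
      unfolding subring_set_def k_def by (auto simp flip: of_nat_add of_nat_mult intro: rangeI) (metis of_nat_1 rangeI)
  qed
  ultimately show ?thesis
    using that by blast
qed

lemma exponent_bound:
  assumes "card (carrier R) = p ^ r" "Factorial_Ring.prime p" "c > 0"
    and "is_33c_group (Sp4 R) c \<or> is_33c_group (PSp4 R) c"
  shows "r \<le> 216 * (2 * c) * (2 * c)"
proof -
  have "p > 1"
    using assms(2) prime_gt_1_nat by blast
  then obtain k :: "'k set" where k: "subring_set k" "finite k" "card k \<le> p"
    using prime_subring[OF assms(1)] by auto
  have "p ^ r \<le> card k ^ (216 * (2 * c) * (2 * c))"
    using card_le_Sp4 card_le_PSp4 assms k by metis
  also have "\<dots> \<le> p ^ (216 * (2 * c) * (2 * c))"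
    using k(3) by (rule power_mono) simp
  finally show ?thesis
    using \<open>p > 1\<close> power_le_imp_le_exp by blast
qed

end

text \<open>The parameters p, r, c are bound inside, so that a single field can stand for every
  counterexample.\<close>

definition exceeds_bound :: "nat ring \<Rightarrow> bool" where
  "exceeds_bound F \<longleftrightarrow> finite (carrier F) \<and> (\<exists>p r c. Factorial_Ring.prime p \<and> c > 0 \<and>
     card (carrier F) = p ^ r \<and> r > 216 * (2 * c) * (2 * c) \<and>
     (is_33c_group (Sp4 F) c \<or> is_33c_group (PSp4 F) c))"

text \<open>A type cannot depend on the field of the theorem. Therefore one field is fixed globally: a
  counterexample to the bound if there is any, and an arbitrary field otherwise. Its carrier becomes
  a type of class \<^class>\<open>field\<close>, which then has an algebraic closure as a type.\<close>

definition test_field :: "nat ring" where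
  "test_field = (SOME F. field F \<and> ((\<exists>F'. field F' \<and> exceeds_bound F') \<longrightarrow> exceeds_bound F))"

lemma test_field:
  "field test_field" "field F \<Longrightarrow> exceeds_bound F \<Longrightarrow> exceeds_bound test_field"
proof -
  \<comment> \<open>The choice must denote a field even without a counterexample; the rationals,
    coded as natural numbers, provide one.\<close>
  have "field (ring_of_type_algebra :: rat ring)"
    by (rule field_from_type_algebra)
  then have "field (image_ring (to_nat :: rat \<Rightarrow> nat) ring_of_type_algebra)"
    by (rule field.inj_imp_image_ring_is_field) (simp add: inj_on_def)
  then have "\<exists>F :: nat ring. field F \<and> ((\<exists>F'. field F' \<and> exceeds_bound F') \<longrightarrow> exceeds_bound F)"
    by blast
  from someI_ex[OF this, folded test_field_def]
  show "field test_field" "field F \<Longrightarrow> exceeds_bound F \<Longrightarrow> exceeds_bound test_field"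
    by blast+
qed

interpretation T: cring test_field
  using test_field(1) by (simp add: field_def domain_def)

typedef test_elem = "carrier test_field"
  using T.zero_closed by blast

setup_lifting type_definition_test_elem

instantiation test_elem :: field
begin

lift_definition zero_test_elem :: test_elem is "\<zero>\<^bsub>test_field\<^esub>"
  by (rule T.zero_closed)

lift_definition one_test_elem :: test_elem is "\<one>\<^bsub>test_field\<^esub>"
  by (rule T.one_closed)

lift_definition plus_test_elem :: "test_elem \<Rightarrow> test_elem \<Rightarrow> test_elem" is "add test_field"
  by (rule T.add.m_closed)

lift_definition times_test_elem :: "test_elem \<Rightarrow> test_elem \<Rightarrow> test_elem" is "monoid.mult test_field"
  by (rule T.m_closed)

lift_definition uminus_test_elem :: "test_elem \<Rightarrow> test_elem" is "a_inv test_field"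
  by (rule T.a_inv_closed)

definition minus_test_elem :: "test_elem \<Rightarrow> test_elem \<Rightarrow> test_elem" where
  "minus_test_elem a b = a + - b"

text \<open>The class requires inverse 0 = 0, whereas \<open>m_inv\<close> is unspecified at
  zero.\<close>

lift_definition inverse_test_elem :: "test_elem \<Rightarrow> test_elem" is
  "\<lambda>a. if a = \<zero>\<^bsub>test_field\<^esub> then \<zero>\<^bsub>test_field\<^esub> else m_inv test_field a"
  using field.field_Units[OF test_field(1)] by auto

definition divide_test_elem :: "test_elem \<Rightarrow> test_elem \<Rightarrow> test_elem" where
  "divide_test_elem a b = a * inverse b"

instance
proof
  fix a b c :: test_elem
  show "a * b * c = a * (b * c)" "a + b + c = a + (b + c)" "(a + b) * c = a * c + b * c"
    by (transfer, simp add: T.m_assoc T.a_assoc T.l_distr)+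
  show "a * b = b * a" "a + b = b + a"
    by (transfer, simp add: T.m_comm T.a_comm)+
  show "1 * a = a" "0 + a = a" "- a + a = 0"
    by (transfer, simp add: T.l_neg)+
  show "(0::test_elem) \<noteq> 1"
    using domain.one_not_zero[of test_field] test_field(1) by transfer (auto simp: field_def)
  show "a \<noteq> 0 \<Longrightarrow> inverse a * a = 1"
    by transfer (simp add: field.field_Units[OF test_field(1)])
  show "inverse (0::test_elem) = 0"
    by transfer simp
qed (simp_all add: minus_test_elem_def divide_test_elem_def)

end

text \<open>A counterexample F turns \<open>test_field\<close> into one. This field embeds in the
  algebraic closure of \<open>test_elem\<close>, where \<open>exponent_bound\<close> refutes
  it.\<close>

lemma not_exceeds_bound:
  assumes "field F"
  shows "\<not> exceeds_bound F"
proof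
  assume "exceeds_bound F"
  then have bad: "exceeds_bound test_field"
    using test_field(2) assms by blast
  interpret field_embedding test_field "to_ac \<circ> Abs_test_elem"
  proof (intro field_embedding.intro field_embedding_axioms.intro test_field(1))
    show "finite (carrier test_field)"
      using bad by (simp add: exceeds_bound_def)
    show "inj_on (to_ac \<circ> Abs_test_elem) (carrier test_field)"
      by (auto simp: inj_on_def Abs_test_elem_inject)
    show "(to_ac \<circ> Abs_test_elem) \<zero>\<^bsub>test_field\<^esub> = 0" "(to_ac \<circ> Abs_test_elem) \<one>\<^bsub>test_field\<^esub> = 1"
      by (simp_all flip: zero_test_elem_def one_test_elem_def)
    fix a b assume "a \<in> carrier test_field" "b \<in> carrier test_field"
    then show "(to_ac \<circ> Abs_test_elem) (a \<oplus>\<^bsub>test_field\<^esub> b) = (to_ac \<circ> Abs_test_elem) a + (to_ac \<circ> Abs_test_elem) b"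
      "(to_ac \<circ> Abs_test_elem) (a \<otimes>\<^bsub>test_field\<^esub> b) = (to_ac \<circ> Abs_test_elem) a * (to_ac \<circ> Abs_test_elem) b"
      by (simp_all add: plus_test_elem.abs_eq times_test_elem.abs_eq eq_onp_same_args
          flip: to_ac_add to_ac_mult)
  qed
  obtain p r c where "Factorial_Ring.prime p" "c > 0" "card (carrier test_field) = p ^ r"
    "is_33c_group (Sp4 test_field) c \<or> is_33c_group (PSp4 test_field) c" and r: "r > 216 * (2 * c) * (2 * c)"
    using bad unfolding exceeds_bound_def by blast
  then have "r \<le> 216 * (2 * c) * (2 * c)"
    by (intro exponent_bound)
  then show False
    using r by simp
qed

theorem mainTheorem8:
  fixes p c :: nat
  assumes "Factorial_Ring.prime p" and "c > 0"
  shows "finite {r::nat. r > 0 \<and> (\<exists>F :: nat ring. field F \<and> finite (carrier F) \<and>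
             card (carrier F) = p ^ r \<and> is_33c_group (Sp4 F) c)} \<and>
         finite {r::nat. r > 0 \<and> (\<exists>F :: nat ring. field F \<and> finite (carrier F) \<and>
             card (carrier F) = p ^ r \<and> is_33c_group (PSp4 F) c)}"
proof -
  \<comment> \<open>The bound on r depends on c alone, so it serves every prime p.\<close>
  have "r \<le> 216 * (2 * c) * (2 * c)"
    if "field F" "finite (carrier F)" "card (carrier F) = p ^ r"
      "is_33c_group (Sp4 F) c \<or> is_33c_group (PSp4 F) c" for r and F :: "nat ring"
    using not_exceeds_bound[OF that(1)] that assms unfolding exceeds_bound_def by (meson not_le_imp_less)
  then have "{r. r > 0 \<and> (\<exists>F :: nat ring. field F \<and> finite (carrier F) \<and>
             card (carrier F) = p ^ r \<and> is_33c_group (Sp4 F) c)} \<subseteq> {..216 * (2 * c) * (2 * c)}"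
    "{r. r > 0 \<and> (\<exists>F :: nat ring. field F \<and> finite (carrier F) \<and>
             card (carrier F) = p ^ r \<and> is_33c_group (PSp4 F) c)} \<subseteq> {..216 * (2 * c) * (2 * c)}"
    by blast+
  then show ?thesis
    using finite_atMost finite_subset by blast
qed

end
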